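(* For every integer $c \geq 2$, the problem Max-$c$-Lin-2 Above Average can be solved in $O(2^{(c(c+1)/2)k}\cdot m)$ time, where $k$ is the parameter and $m$ is the number of equations.
   Context: Max-$c$-Lin-2 Above Average: the input is a parameter $k\ge 0$ and a system $F$ of $m$ linear equations over $\mathbb{F}_2$, each of the form $\sum_{i\in T}x_i=b$ with $b\in\{0,1\}$ and at most $c$ variables, each equation $e$ having a positive integer weight $w(e)$. The weight of an assignment is the total weight of the equations it satisfies. Let $W$ be the total weight of all equations. The question is whether there is an assignment of weight at least $W/2+k/2$.
   Formalization: Every equation must contain at least one variable (with equations 0=1 allowed, W/2 is not the average and k=0 already encodes Max-Cut, so the claim would give P=NP); for m=0 only correctness is claimed, not the time bound. Time is counted on a unit-cost RAM with addition and subtraction. *)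

theory Defs
  imports Complex_Main "HOL-Library.Z2"
begin

section \<open>Weighted systems of linear equations over the two-element field\<close>

record lin_eq =
  eq_vars :: "nat set"
  eq_rhs :: bit
  eq_weight :: nat

text \<open>
  A system is a list, so that an equation may be repeated and the same left-hand side may occur
  with both right-hand sides. Left-hand sides are required to be non-empty: the average
  weight of an assignment is half the total weight only if no equation is constant.
\<close>

definition c_lin_system :: "nat \<Rightarrow> lin_eq list \<Rightarrow> bool" where
  "c_lin_system c F \<longleftrightarrow>
     (\<forall>e \<in> set F. finite (eq_vars e) \<and> eq_vars e \<noteq> {} \<and> card (eq_vars e) \<le> c \<and> eq_weight e > 0)"

definition satisfies :: "(nat \<Rightarrow> bit) \<Rightarrow> lin_eq \<Rightarrow> bool" where
  "satisfies x e \<longleftrightarrow> (\<Sum>i\<in>eq_vars e. x i) = eq_rhs e"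

definition assignment_weight :: "lin_eq list \<Rightarrow> (nat \<Rightarrow> bit) \<Rightarrow> nat" where
  "assignment_weight F x = (\<Sum>e\<leftarrow>filter (satisfies x) F. eq_weight e)"

definition total_weight :: "lin_eq list \<Rightarrow> nat" where
  "total_weight F = (\<Sum>e\<leftarrow>F. eq_weight e)"

definition above_average :: "nat \<Rightarrow> lin_eq list \<Rightarrow> bool" where
  "above_average k F \<longleftrightarrow>
     (\<exists>x. real (assignment_weight F x) \<ge> real (total_weight F) / 2 + real k / 2)"

section \<open>Random access machines with unit cost\<close>

text \<open>
  The random access machine of Cook and Reckhow: registers \<open>X\<^sub>0, X\<^sub>1, \<dots>\<close> holding integers, initially
  all zero, and a read-only input sequence of integers. The only arithmetic operations are addition
  and subtraction. Every executed instruction costs one time unit.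
  The machine halts when the program counter leaves the program.
\<close>

datatype instr =
    Const nat int          \<comment> \<open>\<open>X\<^sub>i := n\<close>\<close>
  | Add nat nat nat        \<comment> \<open>\<open>X\<^sub>i := X\<^sub>j + X\<^sub>l\<close>\<close>
  | Sub nat nat nat        \<comment> \<open>\<open>X\<^sub>i := X\<^sub>j - X\<^sub>l\<close>\<close>
  | Load nat nat           \<comment> \<open>\<open>X\<^sub>i := X\<close> at address \<open>X\<^sub>j\<close>\<close>
  | Store nat nat          \<comment> \<open>\<open>X\<close> at address \<open>X\<^sub>i\<close> \<open>:= X\<^sub>j\<close>\<close>
  | JumpPos nat nat        \<comment> \<open>if \<open>X\<^sub>j > 0\<close>, go to instruction \<open>l\<close>\<close>
  | Read nat               \<comment> \<open>\<open>X\<^sub>i :=\<close> next input value\<close>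

record config =
  pc :: nat
  regs :: "nat \<Rightarrow> int"
  inp :: "int list"

text \<open>
  By convention a negative address denotes register 0, and reading beyond the end of the input
  yields 0.
\<close>

fun exec_instr :: "instr \<Rightarrow> config \<Rightarrow> config" where
  "exec_instr (Const i n) s = s\<lparr>pc := pc s + 1, regs := (regs s)(i := n)\<rparr>"
| "exec_instr (Add i j l) s = s\<lparr>pc := pc s + 1, regs := (regs s)(i := regs s j + regs s l)\<rparr>"
| "exec_instr (Sub i j l) s = s\<lparr>pc := pc s + 1, regs := (regs s)(i := regs s j - regs s l)\<rparr>"
| "exec_instr (Load i j) s = s\<lparr>pc := pc s + 1, regs := (regs s)(i := regs s (nat (regs s j)))\<rparr>"
| "exec_instr (Store i j) s = s\<lparr>pc := pc s + 1, regs := (regs s)(nat (regs s i) := regs s j)\<rparr>"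
| "exec_instr (JumpPos j l) s = s\<lparr>pc := (if regs s j > 0 then l else pc s + 1)\<rparr>"
| "exec_instr (Read i) s =
     s\<lparr>pc := pc s + 1,
       regs := (regs s)(i := (case inp s of [] \<Rightarrow> 0 | v # _ \<Rightarrow> v)),
       inp := tl (inp s)\<rparr>"

definition halted :: "instr list \<Rightarrow> config \<Rightarrow> bool" where
  "halted P s \<longleftrightarrow> pc s \<ge> length P"

definition step :: "instr list \<Rightarrow> config \<Rightarrow> config" where
  "step P s = (if halted P s then s else exec_instr (P ! pc s) s)"

definition initial_config :: "int list \<Rightarrow> config" where
  "initial_config zs = \<lparr>pc = 0, regs = (\<lambda>_. 0), inp = zs\<rparr>"

text \<open>Halted configurations are fixed points of \<open>step\<close>, so \<open>t\<close> is an upper bound on the number of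
  executed instructions. The output is the final content of register 0.\<close>

definition outputs_within :: "instr list \<Rightarrow> int list \<Rightarrow> nat \<Rightarrow> int \<Rightarrow> bool" where
  "outputs_within P zs t v \<longleftrightarrow>
     (let s = (step P ^^ t) (initial_config zs) in halted P s \<and> regs s 0 = v)"

section \<open>Encoding of instances\<close>

text \<open>
  An equation is written as the number of its variables, their indices in an arbitrary order, the
  right-hand side and the weight; an instance as the parameter, the number of equations and the
  equations one after the other.
\<close>

definition encodes_eq :: "lin_eq \<Rightarrow> int list \<Rightarrow> bool" where
  "encodes_eq e zs \<longleftrightarrow>
     (\<exists>xs. distinct xs \<and> set xs = eq_vars e \<and>
        zs = [int (length xs)] @ map int xs @ [of_bool (eq_rhs e = 1), int (eq_weight e)])"

definition encodes_instance :: "nat \<Rightarrow> lin_eq list \<Rightarrow> int list \<Rightarrow> bool" where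
  "encodes_instance k F zs \<longleftrightarrow>
     (\<exists>zss. list_all2 encodes_eq F zss \<and> zs = [int k, int (length F)] @ concat zss)"

end

theory Submission
  imports Defs
begin

text \<open>
  Satisfied minus falsified weight is a multilinear polynomial in signs, \<open>excess X = \<Sum>S. a S * chi S X\<close>
  with \<open>chi S X = (-1)^|S \<inter> X|\<close>, once equations with equal left-hand sides are merged; the question
  is whether it reaches \<open>k\<close>. For \<open>j = c, \<dots>, 1\<close> greedily mark all variables of terms that still have
  \<open>j\<close> unmarked ones. If \<open>V\<close> was marked before level \<open>j\<close>, the sets \<open>S - V\<close> picked at that level are
  disjoint of maximal size \<open>j\<close>; choosing the values on \<open>V\<close> at random and then giving each
  \<open>chi (S - V)\<close> the sign of its restricted coefficient shows that the maximal excess is at least the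
  number of sets picked. So either more than \<open>c(c+1)/2 * (k-1)\<close> variables are marked and the answer is
  yes, or all assignments of the marked variables, which cover all remaining terms, can be tried.
\<close>

section \<open>Polynomials in signs\<close>

text \<open>Merging is essential: a left-hand side whose coefficient cancels to 0 must not be
  picked, because the lower bound needs every restricted coefficient of a picked set to be a nonzero
  polynomial. Different left-hand sides with the same part outside \<open>V\<close> differ inside
  \<open>V\<close>, so restricting creates no new cancellation, and integrality yields an average
  absolute value of at least 1. The number c(c+1)/2 is 1 + ... + c: in a no-instance level j picks
  at most k - 1 sets, each with j new variables. Linear dependence on m rules out comparing
  left-hand sides pairwise, and the machine has neither multiplication nor bit operations. Equal
  left-hand sides therefore meet in one array cell, addressed by a sum of powers of two; unit cost
  for large numbers and addresses makes this affordable. All programs are written in a small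
  structured language with explicit step counts, whose compilation loses only a constant
  factor.\<close>

definition chi :: "nat set \<Rightarrow> nat set \<Rightarrow> int" where
  "chi S X = (-1) ^ card (S \<inter> X)"

definition flip :: "nat \<Rightarrow> nat set \<Rightarrow> nat set" where
  "flip v X = (if v \<in> X then X - {v} else insert v X)"

lemma flip_flip: "flip v (flip v X) = X"
  by (auto simp: flip_def)

lemma flip_commute: "flip v (flip w X) = flip w (flip v X)"
  by (auto simp: flip_def)

lemma flip_subset: "v \<in> W \<Longrightarrow> X \<subseteq> W \<Longrightarrow> flip v X \<subseteq> W"
  by (auto simp: flip_def)

lemma chi_empty [simp]: "chi {} X = 1"
  by (simp add: chi_def)

lemma chi_square: "chi S X * chi S X = 1"
  by (simp add: chi_def flip: power_mult_distrib)

lemma abs_chi: "\<bar>chi S X\<bar> = 1"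
  by (simp add: chi_def power_abs)

lemma chi_flip_notin: "v \<notin> S \<Longrightarrow> chi S (flip v X) = chi S X"
proof -
  assume "v \<notin> S"
  then have "S \<inter> flip v X = S \<inter> X"
    by (auto simp: flip_def)
  then show ?thesis
    by (simp add: chi_def)
qed

lemma chi_flip_in: "finite S \<Longrightarrow> v \<in> S \<Longrightarrow> chi S (flip v X) = - chi S X"
proof (cases "v \<in> X")
  case True
  assume S: "finite S" "v \<in> S"
  have "S \<inter> X = insert v (S \<inter> flip v X)" "v \<notin> S \<inter> flip v X"
    using True S by (auto simp: flip_def)
  then have "card (S \<inter> X) = Suc (card (S \<inter> flip v X))"
    using S by simp
  then show ?thesis
    by (simp add: chi_def)
next
  case False
  assume S: "finite S" "v \<in> S"
  have "S \<inter> flip v X = insert v (S \<inter> X)" "v \<notin> S \<inter> X"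
    using False S by (auto simp: flip_def)
  then have "card (S \<inter> flip v X) = Suc (card (S \<inter> X))"
    using S by simp
  then show ?thesis
    by (simp add: chi_def)
qed

lemma chi_Un:
  assumes "finite S" "finite S'" "S \<inter> S' = {}"
  shows "chi (S \<union> S') X = chi S X * chi S' X"
proof -
  have "(S \<union> S') \<inter> X = (S \<inter> X) \<union> (S' \<inter> X)"
    by auto
  moreover have "card ((S \<inter> X) \<union> (S' \<inter> X)) = card (S \<inter> X) + card (S' \<inter> X)"
    using assms by (intro card_Un_disjoint) auto
  ultimately show ?thesis
    by (simp add: chi_def power_add)
qed

text \<open>The common part \<open>S \<inter> S'\<close> contributes a square, which is 1; the
  symmetric difference remains.\<close>

lemma chi_mult:
  assumes "finite S" "finite S'"
  shows "chi S X * chi S' X = chi ((S - S') \<union> (S' - S)) X"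
proof -
  have "chi S X = chi (S - S') X * chi (S \<inter> S') X"
  proof (subst chi_Un[symmetric])
    show "chi S X = chi (S - S' \<union> S \<inter> S') X"
      by (rule arg_cong[of _ _ "\<lambda>S. chi S X"]) blast
  qed (use assms in auto)
  moreover have "chi S' X = chi (S' - S) X * chi (S \<inter> S') X"
  proof (subst chi_Un[symmetric])
    show "chi S' X = chi (S' - S \<union> S \<inter> S') X"
      by (rule arg_cong[of _ _ "\<lambda>S. chi S X"]) blast
  qed (use assms in auto)
  moreover have "chi ((S - S') \<union> (S' - S)) X = chi (S - S') X * chi (S' - S) X"
    using assms by (intro chi_Un) auto
  moreover have "(a * c) * (b * c) = a * b * (c * c)" for a b c :: int
    by simp
  ultimately show ?thesis
    by (simp only: chi_square mult_1_right)
qed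

section \<open>Vanishing character sums and averaging over assignments\<close>

text \<open>Summands cancel in pairs, and at a fixed point the value is its own negative. In every
  use \<open>\<phi>\<close> flips one or two variables.\<close>

lemma sum_involution_eq_0:
  fixes g :: "'a \<Rightarrow> int"
  assumes "\<And>X. X \<in> A \<Longrightarrow> \<phi> X \<in> A \<and> \<phi> (\<phi> X) = X \<and> g (\<phi> X) = - g X"
  shows "sum g A = 0"
proof -
  have "sum g A = sum (\<lambda>X. - g X) A"
    by (rule sum.reindex_bij_witness[of _ \<phi> \<phi>]) (use assms in auto)
  then show ?thesis
    by (simp add: sum_negf)
qed

text \<open>Flipping one fixed variable of a nonempty \<open>S\<close> reverses the character. With
  products rewritten by \<open>chi_mult\<close> this is orthogonality of characters.\<close>

lemma sum_chi_Pow: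
  assumes "finite V" "S \<subseteq> V"
  shows "(\<Sum>X\<in>Pow V. chi S X) = (if S = {} then 2 ^ card V else 0)"
proof (cases "S = {}")
  case True
  then show ?thesis
    using assms by (simp add: card_Pow)
next
  case False
  then obtain v where v: "v \<in> S"
    by auto
  have "(\<Sum>X\<in>Pow V. chi S X) = 0"
  proof (rule sum_involution_eq_0[of _ "flip v"])
    fix X assume "X \<in> Pow V"
    moreover have "v \<in> V" "finite S"
      using assms v finite_subset by auto
    ultimately show "flip v X \<in> Pow V \<and> flip v (flip v X) = X \<and> chi S (flip v X) = - chi S X"
      using v by (simp add: flip_flip chi_flip_in flip_subset)
  qed
  then show ?thesis
    using False by simp
qed

text \<open>Multiplying by \<open>chi (g i0)\<close> and summing extracts the coefficient of that
  character, which is \<open>A i0\<close> alone since \<open>g\<close> is injective. Factors of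
  absolute value 1 do not affect the sum of absolute values.\<close>

lemma sum_abs_poly_ge:
  assumes "finite V" "finite I" "inj_on g I" "\<And>i. i \<in> I \<Longrightarrow> g i \<subseteq> V" "i0 \<in> I"
  shows "(\<Sum>X\<in>Pow V. \<bar>\<Sum>i\<in>I. A i * chi (g i) X\<bar>) \<ge> \<bar>A i0\<bar> * 2 ^ card V"
proof -
  let ?\<alpha> = "\<lambda>X. \<Sum>i\<in>I. A i * chi (g i) X"
  let ?d = "\<lambda>i. (g i - g i0) \<union> (g i0 - g i)"
  have fin: "finite (g i)" if "i \<in> I" for i
    using assms that by (meson finite_subset)
  have "(\<Sum>X\<in>Pow V. ?\<alpha> X * chi (g i0) X) = (\<Sum>X\<in>Pow V. \<Sum>i\<in>I. A i * chi (?d i) X)"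
    using fin assms(5) by (simp add: sum_distrib_right mult.assoc chi_mult)
  also have "\<dots> = (\<Sum>i\<in>I. A i * (\<Sum>X\<in>Pow V. chi (?d i) X))"
    by (subst sum.swap) (simp add: sum_distrib_left)
  also have "\<dots> = (\<Sum>i\<in>I. if i = i0 then A i0 * 2 ^ card V else 0)"
  proof (rule sum.cong)
    fix i assume i: "i \<in> I"
    have "?d i \<subseteq> V"
      using assms(4)[OF i] assms(4)[OF assms(5)] by auto
    moreover have "?d i = {} \<longleftrightarrow> i = i0"
      using inj_onD[OF assms(3) _ i assms(5)] by auto
    ultimately show "A i * (\<Sum>X\<in>Pow V. chi (?d i) X) = (if i = i0 then A i0 * 2 ^ card V else 0)"
      using sum_chi_Pow[OF assms(1), of "?d i"] by simp
  qed simp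
  also have "\<dots> = A i0 * 2 ^ card V"
    using assms by simp
  finally have "\<bar>A i0\<bar> * 2 ^ card V = \<bar>\<Sum>X\<in>Pow V. ?\<alpha> X * chi (g i0) X\<bar>"
    by (simp add: abs_mult)
  also have "\<dots> \<le> (\<Sum>X\<in>Pow V. \<bar>?\<alpha> X * chi (g i0) X\<bar>)"
    by (rule sum_abs)
  also have "\<dots> = (\<Sum>X\<in>Pow V. \<bar>?\<alpha> X\<bar>)"
    by (simp add: abs_mult abs_chi)
  finally show ?thesis .
qed

lemma exists_ge_average:
  fixes h :: "'a \<Rightarrow> int"
  assumes "finite A" "A \<noteq> {}" "sum h A \<ge> int (card A) * b"
  shows "\<exists>x\<in>A. h x \<ge> b"
proof (rule ccontr)
  assume "\<not> ?thesis"
  then have "sum h A < (\<Sum>x\<in>A. b)"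
    using assms by (intro sum_strict_mono) auto
  then show False
    using assms by simp
qed

text \<open>Average over all \<open>Z\<close> for which every \<open>chi T Z\<close>, \<open>T \<in> \<T>\<close>, has the sign of its coefficient:
  all other characters average to zero, because flipping one or two variables reverses them and
  preserves the constraints.\<close>

lemma exists_ge_sum_abs_disjoint:
  fixes B :: "nat set \<Rightarrow> int"
  assumes "finite W" "\<U> \<subseteq> Pow W" "\<T> \<subseteq> \<U>" "pairwise disjnt \<T>" "{} \<notin> \<T>"
    and split: "\<And>U. U \<in> \<U> \<Longrightarrow> U \<notin> \<T> \<Longrightarrow> (\<exists>v\<in>U. v \<notin> \<Union>\<T>) \<or> (\<exists>T\<in>\<T>. T \<inter> U \<noteq> {} \<and> \<not> T \<subseteq> U)"
  shows "\<exists>Z\<subseteq>W. (\<Sum>U\<in>\<U>. B U * chi U Z) \<ge> (\<Sum>T\<in>\<T>. \<bar>B T\<bar>)"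
proof -
  \<comment> \<open>A zero coefficient gets the sign 1, so \<open>B T * sg T\<close> is the absolute
    value of \<open>B T\<close> in all cases.\<close>
  define sg where "sg = (\<lambda>T. if B T < 0 then -1 else 1 :: int)"
  define \<Omega> where "\<Omega> = {Z \<in> Pow W. \<forall>T\<in>\<T>. chi T Z = sg T}"
  have fin: "finite \<Omega>" "finite \<U>" "finite \<T>" "\<And>U. U \<in> \<U> \<Longrightarrow> finite U"
    using assms by (auto simp: \<Omega>_def dest: finite_subset intro: rev_finite_subset)
  have dj: "T = T'" if "T \<in> \<T>" "T' \<in> \<T>" "v \<in> T" "v \<in> T'" for T T' v
    using assms(4) that by (auto simp: pairwise_def disjnt_def)
  \<comment> \<open>One representative per set. Setting exactly the representatives of sets with
    negative coefficient meets all constraints, because by disjointness no set contains the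
    representative of another.\<close>
  have "\<exists>r. \<forall>T\<in>\<T>. r T \<in> T"
    using assms(5) by (intro bchoice) (metis ex_in_conv)
  then obtain r where r: "\<And>T. T \<in> \<T> \<Longrightarrow> r T \<in> T"
    by auto
  have "r ` {T\<in>\<T>. B T < 0} \<in> \<Omega>"
    unfolding \<Omega>_def
  proof (intro CollectI conjI ballI)
    show "r ` {T\<in>\<T>. B T < 0} \<in> Pow W"
      using r assms(2,3) by blast
    fix T assume T: "T \<in> \<T>"
    have "T \<inter> r ` {T\<in>\<T>. B T < 0} = (if B T < 0 then {r T} else {})"
      using r[OF T] dj[OF _ T r] T by auto
    then show "chi T (r ` {T\<in>\<T>. B T < 0}) = sg T"
      by (simp add: chi_def sg_def)
  qed
  then have ne: "\<Omega> \<noteq> {}"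
    by auto
  have zero: "(\<Sum>Z\<in>\<Omega>. chi U Z) = 0" if U: "U \<in> \<U>" "U \<notin> \<T>" for U
    using split[OF U]
  proof
    assume "\<exists>v\<in>U. v \<notin> \<Union>\<T>"
    then obtain v where v: "v \<in> U" "v \<notin> \<Union>\<T>"
      by auto
    then have W: "v \<in> W"
      using U assms by auto
    show ?thesis
    proof (rule sum_involution_eq_0[of _ "flip v"])
      fix X assume X: "X \<in> \<Omega>"
      have "chi T (flip v X) = chi T X" if "T \<in> \<T>" for T
        using that v by (intro chi_flip_notin) auto
      then show "flip v X \<in> \<Omega> \<and> flip v (flip v X) = X \<and> chi U (flip v X) = - chi U X"
        using X W U v fin(4) by (simp add: \<Omega>_def flip_flip chi_flip_in flip_subset)
    qed
  next
    assume "\<exists>T\<in>\<T>. T \<inter> U \<noteq> {} \<and> \<not> T \<subseteq> U"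
    then obtain T a b where ab: "T \<in> \<T>" "a \<in> T" "a \<in> U" "b \<in> T" "b \<notin> U"
      by auto
    then have W: "a \<in> W" "b \<in> W"
      using assms by auto
    \<comment> \<open>\<open>T\<close> contains both flipped variables and every other member of the
      family contains neither, whereas \<open>U\<close> contains only \<open>a\<close>.\<close>
    have T': "chi T' (flip a (flip b Z)) = chi T' Z" if "T' \<in> \<T>" for T' Z
    proof (cases "T' = T")
      case True
      then show ?thesis
        using ab fin(4)[of T] assms(3) by (auto simp: chi_flip_in)
    next
      case False
      then have "a \<notin> T'" "b \<notin> T'"
        using dj ab that by auto
      then show ?thesis
        by (simp add: chi_flip_notin)
    qed
    show ?thesis
    proof (rule sum_involution_eq_0[of _ "\<lambda>Z. flip a (flip b Z)"])
      fix X assume X: "X \<in> \<Omega>"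
      have "flip a (flip b (flip a (flip b X))) = X"
        by (simp add: flip_commute[of b a] flip_flip)
      then show "flip a (flip b X) \<in> \<Omega> \<and> flip a (flip b (flip a (flip b X))) = X \<and>
          chi U (flip a (flip b X)) = - chi U X"
        using X W U ab fin(4) T' by (simp add: \<Omega>_def chi_flip_in chi_flip_notin flip_subset)
    qed
  qed
  have "(\<Sum>Z\<in>\<Omega>. \<Sum>U\<in>\<U>. B U * chi U Z) = (\<Sum>U\<in>\<U>. B U * (\<Sum>Z\<in>\<Omega>. chi U Z))"
    by (subst sum.swap) (simp add: sum_distrib_left)
  also have "\<dots> = (\<Sum>U\<in>\<T>. B U * (\<Sum>Z\<in>\<Omega>. chi U Z))"
    using fin assms(3) zero by (intro sum.mono_neutral_right) auto
  also have "\<dots> = (\<Sum>T\<in>\<T>. int (card \<Omega>) * \<bar>B T\<bar>)"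
    by (rule sum.cong) (auto simp: \<Omega>_def sg_def)
  also have "\<dots> = int (card \<Omega>) * (\<Sum>T\<in>\<T>. \<bar>B T\<bar>)"
    by (simp add: sum_distrib_left)
  finally have "\<exists>Z\<in>\<Omega>. (\<Sum>U\<in>\<U>. B U * chi U Z) \<ge> (\<Sum>T\<in>\<T>. \<bar>B T\<bar>)"
    using fin ne by (intro exists_ge_average) auto
  then show ?thesis
    by (auto simp: \<Omega>_def)
qed

text \<open>First choose the values on \<open>V\<close>: a uniformly random choice makes the restricted coefficient of
  each \<open>T \<in> \<T>\<close>, a nonzero integer polynomial, at least 1 in absolute value on average.\<close>

lemma exists_ge_card_disjoint:
  fixes A :: "nat set \<Rightarrow> int"
  assumes "finite V" "finite \<S>"
    and S: "\<And>S. S \<in> \<S> \<Longrightarrow> finite S \<and> S \<noteq> {} \<and> A S \<noteq> 0 \<and> card (S - V) \<le> j"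
    and "j > 0" and T: "\<And>T. T \<in> \<T> \<Longrightarrow> card T = j \<and> (\<exists>S\<in>\<S>. T = S - V)" and "pairwise disjnt \<T>"
  shows "\<exists>X. (\<Sum>S\<in>\<S>. A S * chi S X) \<ge> int (card \<T>)"
proof -
  \<comment> \<open>\<open>\<alpha> U Y\<close> is the coefficient of \<open>chi U\<close> that
    remains once the values on \<open>V\<close> are fixed to \<open>Y\<close>.\<close>
  define \<alpha> where "\<alpha> = (\<lambda>U Y. \<Sum>S | S \<in> \<S> \<and> S - V = U. A S * chi (S \<inter> V) Y)"
  \<comment> \<open>The excess guaranteed for a given \<open>Y\<close>: the constant part, plus what
    the disjoint sets gain when their signs are chosen optimally.\<close>
  define h where "h = (\<lambda>Y. \<alpha> {} Y + (\<Sum>T\<in>\<T>. \<bar>\<alpha> T Y\<bar>))"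
  define \<R> where "\<R> = (\<lambda>S. S - V) ` \<S>"
  have "\<T> \<subseteq> \<R>"
    unfolding \<R>_def using T by blast
  moreover have "finite \<R>"
    using assms by (simp add: \<R>_def)
  ultimately have finT: "finite \<T>"
    using finite_subset by blast
  have avg: "(\<Sum>Y\<in>Pow V. \<bar>\<alpha> T Y\<bar>) \<ge> 2 ^ card V" if TT: "T \<in> \<T>" for T
  proof -
    obtain S0 where S0: "S0 \<in> \<S>" "T = S0 - V"
      using T[OF TT] by blast
    have "1 * 2 ^ card V \<le> \<bar>A S0\<bar> * (2 :: int) ^ card V"
      using S[OF S0(1)] by (intro mult_right_mono) auto
    \<comment> \<open>Injectivity holds because a set \<open>S\<close> with \<open>S - V = T\<close>
      is determined by \<open>S \<inter> V\<close>.\<close>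
    also have "\<dots> \<le> (\<Sum>Y\<in>Pow V. \<bar>\<alpha> T Y\<bar>)"
      unfolding \<alpha>_def using assms(1,2) S0
      by (intro sum_abs_poly_ge) (auto simp: inj_on_def)
    finally show ?thesis
      by simp
  qed
  \<comment> \<open>The constant part averages to 0: it collects nonempty sets lying inside
    \<open>V\<close>.\<close>
  have "(\<Sum>Y\<in>Pow V. \<alpha> {} Y) = (\<Sum>S | S \<in> \<S> \<and> S - V = {}. A S * (\<Sum>Y\<in>Pow V. chi (S \<inter> V) Y))"
    unfolding \<alpha>_def by (subst sum.swap) (simp add: sum_distrib_left)
  also have "\<dots> = 0"
    using S by (intro sum.neutral) (auto simp: sum_chi_Pow[OF assms(1)])
  finally have "(\<Sum>Y\<in>Pow V. h Y) = (\<Sum>T\<in>\<T>. \<Sum>Y\<in>Pow V. \<bar>\<alpha> T Y\<bar>)"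
    unfolding h_def by (simp add: sum.distrib sum.swap[of _ \<T>])
  also have "\<dots> \<ge> (\<Sum>T\<in>\<T>. 2 ^ card V)"
    by (intro sum_mono avg)
  finally have "(\<Sum>Y\<in>Pow V. h Y) \<ge> int (card (Pow V)) * int (card \<T>)"
    using assms(1) by (simp add: card_Pow mult.commute)
  then obtain Y where Y: "Y \<subseteq> V" "h Y \<ge> int (card \<T>)"
    using exists_ge_average[of "Pow V" "int (card \<T>)" h] assms(1) by auto
  have "\<exists>Z\<subseteq>\<Union>\<S> - V. (\<Sum>U\<in>\<R> - {{}}. \<alpha> U Y * chi U Z) \<ge> (\<Sum>T\<in>\<T>. \<bar>\<alpha> T Y\<bar>)"
  proof (rule exists_ge_sum_abs_disjoint)
    show "finite (\<Union>\<S> - V)"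
      using assms by auto
    show "{} \<notin> \<T>" "\<T> \<subseteq> \<R> - {{}}"
      using T \<open>j > 0\<close> \<open>\<T> \<subseteq> \<R>\<close> by force+
    fix U assume U: "U \<in> \<R> - {{}}" "U \<notin> \<T>"
    then obtain S where S': "S \<in> \<S>" "U = S - V"
      by (auto simp: \<R>_def)
    then have cU: "card U \<le> j" "finite U"
      using S by auto
    show "(\<exists>v\<in>U. v \<notin> \<Union>\<T>) \<or> (\<exists>T\<in>\<T>. T \<inter> U \<noteq> {} \<and> \<not> T \<subseteq> U)"
    proof (cases "U \<subseteq> \<Union>\<T>")
      case True
      then obtain a T0 where a: "a \<in> U" "a \<in> T0" "T0 \<in> \<T>"
        using U by blast
      \<comment> \<open>Here the maximality of \<open>j\<close> enters:
        \<open>card U \<le> j = card T0\<close>, so inclusion would force \<open>U = T0\<close>, a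
        member of \<open>\<T>\<close>.\<close>
      have "\<not> T0 \<subseteq> U"
        using T[OF a(3)] cU U a(3) card_seteq by metis
      then show ?thesis
        using a by blast
    qed auto
  qed (use assms in \<open>auto simp: \<R>_def\<close>)
  then obtain Z where Z: "Z \<subseteq> \<Union>\<S> - V" "(\<Sum>U\<in>\<R> - {{}}. \<alpha> U Y * chi U Z) \<ge> (\<Sum>T\<in>\<T>. \<bar>\<alpha> T Y\<bar>)"
    by auto
  have chi: "chi S (Y \<union> Z) = chi (S \<inter> V) Y * chi (S - V) Z" if "S \<in> \<S>" for S
  proof -
    have "S \<inter> (Y \<union> Z) = (S \<inter> V \<inter> Y) \<union> ((S - V) \<inter> Z)"
      using Y Z by auto
    moreover have "card ((S \<inter> V \<inter> Y) \<union> ((S - V) \<inter> Z)) = card (S \<inter> V \<inter> Y) + card ((S - V) \<inter> Z)"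
      using S[OF that] by (intro card_Un_disjoint) auto
    ultimately show ?thesis
      by (simp add: chi_def power_add)
  qed
  have "(\<Sum>S\<in>\<S>. A S * chi S (Y \<union> Z)) = (\<Sum>U\<in>\<R>. \<Sum>S | S \<in> \<S> \<and> S - V = U. A S * chi S (Y \<union> Z))"
    unfolding \<R>_def by (rule sum.image_gen[OF assms(2)])
  also have "\<dots> = (\<Sum>U\<in>\<R>. \<alpha> U Y * chi U Z)"
    unfolding \<alpha>_def sum_distrib_right by (intro sum.cong refl) (auto simp: chi)
  also have "\<dots> = \<alpha> {} Y + (\<Sum>U\<in>\<R> - {{}}. \<alpha> U Y * chi U Z)"
  proof (cases "{} \<in> \<R>")
    case True
    then show ?thesis
      using \<open>finite \<R>\<close> by (subst sum.remove[of _ "{}"]) auto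
  next
    case False
    then have "{S \<in> \<S>. S - V = {}} = {}"
      by (auto simp: \<R>_def)
    then have "\<alpha> {} Y = 0"
      by (simp only: \<alpha>_def sum.empty)
    then show ?thesis
      using False by simp
  qed
  finally show ?thesis
    using Y Z by (intro exI[of _ "Y \<union> Z"]) (simp add: h_def)
qed

section \<open>Merged coefficients and greedy marking\<close>

type_synonym term_list = "(nat list \<times> int) list"

definition excess :: "term_list \<Rightarrow> nat set \<Rightarrow> int" where
  "excess us X = (\<Sum>(xs, a)\<leftarrow>us. a * chi (set xs) X)"

definition coef :: "term_list \<Rightarrow> nat set \<Rightarrow> int" where
  "coef us S = (\<Sum>(xs, a)\<leftarrow>us. if set xs = S then a else 0)"

text \<open>The left-hand sides that survive merging. They alone determine the excess, and only they
  satisfy the nonvanishing condition of the lower bound.\<close>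

definition active :: "term_list \<Rightarrow> nat set set" where
  "active us = {S \<in> (\<lambda>(xs, a). set xs) ` set us. coef us S \<noteq> 0}"

lemma sum_list_eq_sum_coef:
  assumes "finite \<S>" "(\<lambda>(xs, a). set xs) ` set us \<subseteq> \<S>"
  shows "(\<Sum>(xs, a)\<leftarrow>us. a * g (set xs)) = (\<Sum>S\<in>\<S>. coef us S * g S)"
  using assms(2)
proof (induction us)
  case Nil
  then show ?case
    by (simp add: coef_def)
next
  case (Cons u us)
  obtain xs a where u: "u = (xs, a)"
    by (cases u)
  have "(\<Sum>S\<in>\<S>. coef (u # us) S * g S) =
      (\<Sum>S\<in>\<S>. (if set xs = S then a * g S else 0) + coef us S * g S)"
    by (intro sum.cong) (auto simp: coef_def u algebra_simps)
  also have "\<dots> = a * g (set xs) + (\<Sum>S\<in>\<S>. coef us S * g S)"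
    using assms(1) Cons.prems by (simp add: sum.distrib u)
  finally show ?case
    using Cons by (simp add: u)
qed

lemma finite_active: "finite (active us)"
  by (simp add: active_def)

lemma excess_eq_sum_active: "excess us X = (\<Sum>S\<in>active us. coef us S * chi S X)"
proof -
  have "excess us X = (\<Sum>S\<in>(\<lambda>(xs, a). set xs) ` set us. coef us S * chi S X)"
    unfolding excess_def by (rule sum_list_eq_sum_coef) auto
  also have "\<dots> = (\<Sum>S\<in>active us. coef us S * chi S X)"
    by (rule sum.mono_neutral_right) (auto simp: active_def)
  finally show ?thesis .
qed

text \<open>Makes exhaustive search over subsets of a covering set \<open>V\<close>
  complete.\<close>

lemma excess_restrict:
  assumes "\<And>S. S \<in> active us \<Longrightarrow> S \<subseteq> V"
  shows "excess us (X \<inter> V) = excess us X"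
proof -
  have "S \<inter> (X \<inter> V) = S \<inter> X" if "S \<in> active us" for S
    using assms that by auto
  then show ?thesis
    by (simp add: excess_eq_sum_active chi_def)
qed

text \<open>The test uses the set marked so far, which grows during a pass, while the analysis of a
  pass refers to the set \<open>V\<close> at its beginning.\<close>

definition mark_step :: "nat set set \<Rightarrow> nat \<Rightarrow> nat list \<times> int \<Rightarrow> nat set \<Rightarrow> nat set" where
  "mark_step Act j u V =
     (if set (fst u) \<in> Act \<and> j \<le> card (set (fst u) - V) then V \<union> set (fst u) else V)"

fun mark_all :: "nat set set \<Rightarrow> nat \<Rightarrow> term_list \<Rightarrow> nat set \<Rightarrow> nat set" where
  "mark_all Act 0 us V = V"
| "mark_all Act (Suc j) us V = mark_all Act j us (fold (mark_step Act (Suc j)) us V)"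

text \<open>At the start every active set has at most \<open>j\<close> unmarked variables, so
  passing the test means that none of these was marked meanwhile; hence the picked sets are disjoint
  and of size \<open>j\<close>. At the end a picked set has no unmarked variable left, and any other
  one already failed the test and can only have lost more.\<close>

lemma mark_pass:
  assumes "finite V" "\<And>S. S \<in> Act \<Longrightarrow> finite S \<and> card (S - V) \<le> j"
  shows "\<exists>\<T>. finite \<T> \<and> (\<forall>T\<in>\<T>. card T = j \<and> (\<exists>S\<in>Act. T = S - V)) \<and> pairwise disjnt \<T> \<and>
    fold (mark_step Act j) us V = V \<union> \<Union>\<T> \<and>
    (j > 0 \<longrightarrow> (\<forall>u\<in>set us. set (fst u) \<in> Act \<longrightarrow> card (set (fst u) - (V \<union> \<Union>\<T>)) < j))"
\<comment> \<open>Induction from the right matches \<open>fold\<close>, which treats the last entry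
  last.\<close>
proof (induction us rule: rev_induct)
  case Nil
  show ?case
    by (intro exI[of _ "{}"]) (auto simp: pairwise_def)
next
  case (snoc u us)
  then obtain \<T> where \<T>: "finite \<T>" "\<forall>T\<in>\<T>. card T = j \<and> (\<exists>S\<in>Act. T = S - V)" "pairwise disjnt \<T>"
      "fold (mark_step Act j) us V = V \<union> \<Union>\<T>"
      "j > 0 \<longrightarrow> (\<forall>u\<in>set us. set (fst u) \<in> Act \<longrightarrow> card (set (fst u) - (V \<union> \<Union>\<T>)) < j)"
    by (elim exE conjE)
  let ?S = "set (fst u)"
  show ?case
  proof (cases "?S \<in> Act \<and> j \<le> card (?S - (V \<union> \<Union>\<T>))")
    case False
    moreover from this have "mark_step Act j u (V \<union> \<Union>\<T>) = V \<union> \<Union>\<T>"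
      unfolding mark_step_def by (rule if_not_P)
    ultimately show ?thesis
      using \<T> by (intro exI[of _ \<T>]) (simp add: not_le)
  next
    case True
    have c: "card (?S - V) \<le> j"
      using assms(2)[of ?S] True by simp
    \<comment> \<open>A subset with at least as many elements as its finite superset is equal to it;
      this yields disjointness from the sets picked before.\<close>
    have eq: "?S - (V \<union> \<Union>\<T>) = ?S - V"
      using True c by (intro card_seteq) auto
    then have dj: "\<And>T. T \<in> \<T> \<Longrightarrow> (?S - V) \<inter> T = {}"
      by blast
    have sub: "card (set xs - (V \<union> \<Union>(insert (?S - V) \<T>))) \<le> card (set xs - (V \<union> \<Union>\<T>))" for xs
      by (intro card_mono) auto
    have "?S - (V \<union> \<Union>(insert (?S - V) \<T>)) = {}"
      by blast
    then have u: "card (?S - (V \<union> \<Union>(insert (?S - V) \<T>))) = 0"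
      by (simp only: card.empty)
    show ?thesis
    proof (intro exI[of _ "insert (?S - V) \<T>"] conjI)
      show "\<forall>T\<in>insert (?S - V) \<T>. card T = j \<and> (\<exists>S\<in>Act. T = S - V)"
      proof
        fix T assume "T \<in> insert (?S - V) \<T>"
        moreover have "card (?S - V) = j"
          using True c eq by simp
        ultimately show "card T = j \<and> (\<exists>S\<in>Act. T = S - V)"
          using \<T>(2) True by blast
      qed
      show "pairwise disjnt (insert (?S - V) \<T>)"
        using \<T>(3) dj by (auto simp: pairwise_insert disjnt_def)
      show "fold (mark_step Act j) (us @ [u]) V = V \<union> \<Union>(insert (?S - V) \<T>)"
        using True by (simp add: \<T>(4) mark_step_def) blast
      show "j > 0 \<longrightarrow> (\<forall>w\<in>set (us @ [u]). set (fst w) \<in> Act \<longrightarrow>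
          card (set (fst w) - (V \<union> \<Union>(insert (?S - V) \<T>))) < j)"
      proof (intro impI ballI)
        fix w assume w: "j > 0" "w \<in> set (us @ [u])" "set (fst w) \<in> Act"
        show "card (set (fst w) - (V \<union> \<Union>(insert (?S - V) \<T>))) < j"
        proof (cases "w = u")
          case True
          show ?thesis
            unfolding True u by (rule w(1))
        next
          case False
          then show ?thesis
            using \<T>(5) w False by (intro le_less_trans[OF sub]) simp
        qed
      qed
    qed (simp add: \<T>(1))
  qed
qed

text \<open>Level \<open>Suc j\<close> spends \<open>Suc j\<close> variables per picked set; this
  adds its share to the bound for the lower levels.\<close>

lemma triangle_Suc: "Suc j * (Suc j + 1) div 2 = j * (j + 1) div 2 + Suc j"
proof -
  have "Suc j * (Suc j + 1) = j * (j + 1) + Suc j * 2"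
    by simp
  then show ?thesis
    by (simp only: div_mult_self1 zero_neq_numeral not_False_eq_True add.commute)
qed

text \<open>Marked variables occur in the input, so their number is at most linear in the number of
  equations.\<close>

lemma mark_all_subset:
  "V \<subseteq> mark_all Act j us V \<and> mark_all Act j us V \<subseteq> V \<union> (\<Union>u\<in>set us. set (fst u))"
proof (induction j arbitrary: V)
  case (Suc j)
  have step: "V \<subseteq> fold (mark_step Act i) ws V \<and>
      fold (mark_step Act i) ws V \<subseteq> V \<union> (\<Union>u\<in>set ws. set (fst u))" for V i ws
    by (induction ws rule: rev_induct) (auto simp: mark_step_def)
  show ?case
    unfolding mark_all.simps
    using Suc[of "fold (mark_step Act (Suc j)) us V"] step[of V "Suc j" us] by blast
qed simp

text \<open>The pass at level \<open>j\<close> leaves fewer than \<open>j\<close> unmarked variables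
  in each active set, hence none after level 1.\<close>

lemma mark_all_covers:
  assumes "finite V" "\<And>S. S \<in> Act \<Longrightarrow> finite S \<and> card (S - V) \<le> j \<and> S \<in> set ` fst ` set us"
    and "S \<in> Act"
  shows "S \<subseteq> mark_all Act j us V"
  using assms(1,2)
proof (induction j arbitrary: V)
  case 0
  then have "card (S - V) = 0" "finite S"
    using assms(3) by auto
  then show ?case
    by simp
next
  case (Suc j)
  let ?V = "fold (mark_step Act (Suc j)) us V"
  obtain \<T> where \<T>: "finite \<T>" "\<forall>T\<in>\<T>. card T = Suc j \<and> (\<exists>S\<in>Act. T = S - V)" "?V = V \<union> \<Union>\<T>"
      "\<forall>u\<in>set us. set (fst u) \<in> Act \<longrightarrow> card (set (fst u) - ?V) < Suc j"
    using mark_pass[of V Act "Suc j" us, OF Suc.prems(1)] Suc.prems(2) by (metis zero_less_Suc)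
  show ?case
    unfolding mark_all.simps
  proof (rule Suc.IH)
    show "finite ?V"
      unfolding \<T>(3) using \<T>(1,2) Suc.prems(1) by (intro finite_UnI finite_Union) (metis card_ge_0_finite zero_less_Suc)+
  qed (use Suc.prems(2) \<T>(4) in force)
qed

text \<open>If the excess stays below \<open>k\<close>, the lower bound allows fewer than
  \<open>k\<close> disjoint sets at each level, and all newly marked variables of a level lie in
  their union.\<close>

lemma card_mark_all:
  assumes us: "\<And>xs a. (xs, a) \<in> set us \<Longrightarrow> xs \<noteq> []"
    and no: "\<And>X. excess us X < int k"
    and "finite V" "\<And>S. S \<in> active us \<Longrightarrow> card (S - V) \<le> j"
  shows "card (mark_all (active us) j us V) \<le> card V + (j * (j + 1) div 2) * (k - 1)"
  using assms(3,4)
proof (induction j arbitrary: V)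
  case (Suc j)
  let ?V = "fold (mark_step (active us) (Suc j)) us V"
  have act: "finite S \<and> S \<noteq> {} \<and> coef us S \<noteq> 0 \<and> S \<in> set ` fst ` set us" if "S \<in> active us" for S
    using that us by (force simp: active_def)
  obtain \<T> where \<T>: "finite \<T>" "\<forall>T\<in>\<T>. card T = Suc j \<and> (\<exists>S\<in>active us. T = S - V)"
      "pairwise disjnt \<T>" "?V = V \<union> \<Union>\<T>"
      "\<forall>u\<in>set us. set (fst u) \<in> active us \<longrightarrow> card (set (fst u) - ?V) < Suc j"
    using mark_pass[of V "active us" "Suc j" us, OF Suc.prems(1)] Suc.prems(2) act by (metis zero_less_Suc)
  have "\<exists>X. (\<Sum>S\<in>active us. coef us S * chi S X) \<ge> int (card \<T>)"
    using Suc.prems \<T> act finite_active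
    by (intro exists_ge_card_disjoint[of V _ _ "Suc j"]) auto
  then have "int (card \<T>) < int k"
    using no by (metis excess_eq_sum_active le_less_trans)
  then have card\<T>: "card \<T> \<le> k - 1"
    by simp
  have "card (\<Union>\<T>) = sum card \<T>"
    using \<T> act by (intro card_Union_disjoint) (auto simp: finite_subset)
  also have "\<dots> = Suc j * card \<T>"
    using \<T> by simp
  also have "\<dots> \<le> Suc j * (k - 1)"
    using card\<T> by (rule mult_le_mono2)
  finally have cV: "card ?V \<le> card V + Suc j * (k - 1)"
    unfolding \<T>(4) using card_Un_le[of V "\<Union>\<T>"] by linarith
  have "finite ?V"
    unfolding \<T>(4) using \<T>(1,2) Suc.prems(1) by (intro finite_UnI finite_Union) (metis card_ge_0_finite zero_less_Suc)+
  moreover have "card (S - ?V) \<le> j" if "S \<in> active us" for S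
    using \<T>(5) act[OF that] that by force
  ultimately have "card (mark_all (active us) j us ?V) \<le> card ?V + (j * (j + 1) div 2) * (k - 1)"
    by (rule Suc.IH)
  then show ?case
    using cV unfolding triangle_Suc by (simp add: add_mult_distrib)
qed simp

section \<open>A structured language for the random access machine\<close>

datatype var = RES | PARAM | NEQS | NVARS | PTR | EQS | LEFT | CUR | TMP | MASK | WT | POW
  | LEVEL | FREE | PTR2 | LEFT2 | BOUND | GO | TOTAL | PARITY | IDX | CARRY

text \<open>\<open>Eqs\<close> keeps the equations, \<open>Code\<close> the codes of variables,
  \<open>Coef\<close> the merged coefficients addressed by code sums, \<open>Mark\<close> and
  \<open>Order\<close> the marked set as indicator and as list, \<open>Val\<close> the assignment
  under test.\<close>

datatype arr = Eqs | Code | Coef | Mark | Order | Val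

datatype opnd = Imm int | Reg var

datatype cmd = Skip | Plus var opnd opnd | Minus var opnd opnd | Get var arr var
  | Put arr var opnd | Input var | Seq cmd cmd (infixr ";;" 60) | Cond var cmd cmd | Loop var cmd

record hstate =
  vs :: "var \<Rightarrow> int"
  ar :: "arr \<Rightarrow> nat \<Rightarrow> int"
  ip :: "int list"

fun opval :: "opnd \<Rightarrow> hstate \<Rightarrow> int" where
  "opval (Imm n) s = n"
| "opval (Reg x) s = vs s x"

definition set_var :: "var \<Rightarrow> int \<Rightarrow> hstate \<Rightarrow> hstate" where
  "set_var x n s = s\<lparr>vs := (vs s)(x := n)\<rparr>"

definition set_cell :: "arr \<Rightarrow> nat \<Rightarrow> int \<Rightarrow> hstate \<Rightarrow> hstate" where
  "set_cell a i n s = s\<lparr>ar := (ar s)(a := (ar s a)(i := n))\<rparr>"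

definition next_input :: "int list \<Rightarrow> int" where
  "next_input zs = (case zs of [] \<Rightarrow> 0 | v # _ \<Rightarrow> v)"

text \<open>Each basic statement and each test costs one unit. Array access has an execution only at
  a nonnegative index, so the convention of the machine for negative addresses never
  matters.\<close>

inductive exec :: "cmd \<Rightarrow> hstate \<Rightarrow> nat \<Rightarrow> hstate \<Rightarrow> bool" where
  Skip: "exec Skip s 1 s"
| Plus: "exec (Plus x a b) s 1 (set_var x (opval a s + opval b s) s)"
| Minus: "exec (Minus x a b) s 1 (set_var x (opval a s - opval b s) s)"
| Get: "vs s y \<ge> 0 \<Longrightarrow> exec (Get x a y) s 1 (set_var x (ar s a (nat (vs s y))) s)"
| Put: "vs s y \<ge> 0 \<Longrightarrow> exec (Put a y b) s 1 (set_cell a (nat (vs s y)) (opval b s) s)"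
| Input: "exec (Input x) s 1 ((set_var x (next_input (ip s)) s)\<lparr>ip := tl (ip s)\<rparr>)"
| Seq: "exec c1 s t1 s1 \<Longrightarrow> exec c2 s1 t2 s2 \<Longrightarrow> exec (c1 ;; c2) s (t1 + t2) s2"
| CondT: "vs s x > 0 \<Longrightarrow> exec c1 s t s' \<Longrightarrow> exec (Cond x c1 c2) s (Suc t) s'"
| CondF: "vs s x \<le> 0 \<Longrightarrow> exec c2 s t s' \<Longrightarrow> exec (Cond x c1 c2) s (Suc t) s'"
| LoopF: "vs s x \<le> 0 \<Longrightarrow> exec (Loop x b) s 1 s"
| LoopT: "vs s x > 0 \<Longrightarrow> exec b s t1 s1 \<Longrightarrow> exec (Loop x b) s1 t2 s2 \<Longrightarrow>
    exec (Loop x b) s (Suc (t1 + t2)) s2"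

fun vreg :: "var \<Rightarrow> nat" where
  "vreg RES = 0" | "vreg PARAM = 1" | "vreg NEQS = 2" | "vreg NVARS = 3" | "vreg PTR = 4"
| "vreg EQS = 5" | "vreg LEFT = 6" | "vreg CUR = 7" | "vreg TMP = 8" | "vreg MASK = 9"
| "vreg WT = 10" | "vreg POW = 11" | "vreg LEVEL = 12" | "vreg FREE = 13" | "vreg PTR2 = 14"
| "vreg LEFT2 = 15" | "vreg BOUND = 16" | "vreg GO = 17" | "vreg TOTAL = 18" | "vreg PARITY = 19"
| "vreg IDX = 20" | "vreg CARRY = 21"

fun areg :: "arr \<Rightarrow> nat" where
  "areg Eqs = 0" | "areg Code = 1" | "areg Coef = 2" | "areg Mark = 3" | "areg Order = 4"
| "areg Val = 5"

text \<open>Cell \<open>i\<close> of an array lives at address \<open>8 i + 32\<close> plus the number of the array, and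
  registers 29, 30, 31 are scratch.\<close>

definition cell :: "arr \<Rightarrow> nat \<Rightarrow> nat" where
  "cell a i = 8 * i + 32 + areg a"

lemma vreg_less: "vreg x < 29"
  by (cases x) auto

lemma vreg_inj: "vreg x = vreg y \<longleftrightarrow> x = y"
  by (cases x; cases y) auto

lemma areg_less: "areg a < 8"
  by (cases a) auto

lemma areg_inj: "areg a = areg b \<longleftrightarrow> a = b"
  by (cases a; cases b) auto

lemma cell_inj: "cell a i = cell b j \<longleftrightarrow> a = b \<and> i = j"
proof
  assume h: "cell a i = cell b j"
  have "cell a i mod 8 = areg a" "cell b j mod 8 = areg b"
    using areg_less[of a] areg_less[of b] by (simp_all add: cell_def mod_add_eq[symmetric])
  then have "a = b"
    using h areg_inj by metis
  then show "a = b \<and> i = j"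
    using h by (simp add: cell_def)
qed auto

lemma cell_neq: "vreg x \<noteq> cell a i" "cell a i \<noteq> vreg x" "cell a i \<noteq> 29" "cell a i \<noteq> 30"
  "cell a i \<noteq> 31" "29 \<noteq> cell a i" "30 \<noteq> cell a i" "31 \<noteq> cell a i"
  "vreg x \<noteq> 29" "vreg x \<noteq> 30" "vreg x \<noteq> 31" "29 \<noteq> vreg x" "30 \<noteq> vreg x" "31 \<noteq> vreg x"
  using vreg_less[of x] by (auto simp: cell_def)

text \<open>The machine has no copy instruction; a register is copied by adding it to 0.\<close>

fun opcode :: "opnd \<Rightarrow> nat \<Rightarrow> instr list" where
  "opcode (Imm n) r = [Const r n]"
| "opcode (Reg x) r = [Const r 0, Add r r (vreg x)]"

text \<open>Three doublings replace the multiplication by 8.\<close>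

definition addr_code :: "arr \<Rightarrow> var \<Rightarrow> instr list" where
  "addr_code a x =
     [Add 30 (vreg x) (vreg x), Add 30 30 30, Add 30 30 30, Const 31 (32 + int (areg a)), Add 30 30 31]"

fun csize :: "cmd \<Rightarrow> nat" where
  "csize Skip = 0"
| "csize (Plus x a b) = length (opcode a 29) + length (opcode b 30) + 1"
| "csize (Minus x a b) = length (opcode a 29) + length (opcode b 30) + 1"
| "csize (Get x a y) = 6"
| "csize (Put a y b) = length (opcode b 29) + 6"
| "csize (Input x) = 1"
| "csize (c1 ;; c2) = csize c1 + csize c2"
| "csize (Cond x c1 c2) = csize c1 + csize c2 + 3"
| "csize (Loop x b) = csize b + 5"

text \<open>Jump targets are absolute, hence the start position \<open>p\<close>; sizes do not
  depend on it. An unconditional jump is a conditional one on scratch register 31 after loading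
  1.\<close>

fun compile :: "nat \<Rightarrow> cmd \<Rightarrow> instr list" where
  "compile p Skip = []"
| "compile p (Plus x a b) = opcode a 29 @ opcode b 30 @ [Add (vreg x) 29 30]"
| "compile p (Minus x a b) = opcode a 29 @ opcode b 30 @ [Sub (vreg x) 29 30]"
| "compile p (Get x a y) = addr_code a y @ [Load (vreg x) 30]"
| "compile p (Put a y b) = addr_code a y @ opcode b 29 @ [Store 30 29]"
| "compile p (Input x) = [Read (vreg x)]"
| "compile p (c1 ;; c2) = compile p c1 @ compile (p + csize c1) c2"
| "compile p (Cond x c1 c2) =
     [JumpPos (vreg x) (p + csize c2 + 3)] @ compile (p + 1) c2 @
     [Const 31 1, JumpPos 31 (p + csize c2 + 3 + csize c1)] @ compile (p + csize c2 + 3) c1"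
| "compile p (Loop x b) =
     [JumpPos (vreg x) (p + 3), Const 31 1, JumpPos 31 (p + csize b + 5)] @ compile (p + 3) b @
     [Const 31 1, JumpPos 31 p]"

lemma length_compile: "length (compile p c) = csize c"
  by (induction c arbitrary: p) (auto simp: addr_code_def)

section \<open>Simulation with constant overhead\<close>

fun code_at :: "instr list \<Rightarrow> nat \<Rightarrow> instr list \<Rightarrow> bool" where
  "code_at P p [] \<longleftrightarrow> True"
| "code_at P p (i # is) \<longleftrightarrow> p < length P \<and> P ! p = i \<and> code_at P (Suc p) is"

lemma code_at_append: "code_at P p (xs @ ys) \<longleftrightarrow> code_at P p xs \<and> code_at P (p + length xs) ys"
  by (induction xs arbitrary: p) auto

lemma code_at_suffix: "code_at (xs @ ys) (length xs) ys"
proof (induction ys arbitrary: xs)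
  case (Cons y ys)
  show ?case
    using Cons[of "xs @ [y]"] by simp
qed simp

fun straight :: "instr \<Rightarrow> bool" where
  "straight (JumpPos _ _) \<longleftrightarrow> False"
| "straight _ \<longleftrightarrow> True"

lemma pc_exec_straight: "straight i \<Longrightarrow> pc (exec_instr i s) = Suc (pc s)"
  by (cases i) auto

lemma steps_straight:
  assumes "code_at P (pc s) is" "\<forall>i \<in> set is. straight i"
  shows "(step P ^^ length is) s = fold exec_instr is s"
  using assms
proof (induction "is" arbitrary: s)
  case (Cons i "is")
  have "step P s = exec_instr i s"
    using Cons.prems by (simp add: step_def halted_def)
  moreover have "(step P ^^ length is) (exec_instr i s) = fold exec_instr is (exec_instr i s)"
    using Cons.prems by (intro Cons.IH) (simp_all add: pc_exec_straight)
  ultimately show ?case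
    by (simp add: funpow_Suc_right del: funpow.simps)
qed simp

text \<open>Program counter and scratch registers are left open, so compiled code may overwrite the
  latter at will.\<close>

definition represents :: "config \<Rightarrow> hstate \<Rightarrow> bool" where
  "represents C s \<longleftrightarrow> (\<forall>x. regs C (vreg x) = vs s x) \<and> (\<forall>a i. regs C (cell a i) = ar s a i) \<and>
     inp C = ip s"

definition simulates :: "instr list \<Rightarrow> config \<Rightarrow> nat \<Rightarrow> nat \<Rightarrow> hstate \<Rightarrow> bool" where
  "simulates P C T q s \<longleftrightarrow>
     (\<exists>t \<le> T. pc ((step P ^^ t) C) = q \<and> represents ((step P ^^ t) C) s)"

lemma simulatesI:
  "(step P ^^ t) C = C' \<Longrightarrow> t \<le> T \<Longrightarrow> pc C' = q \<Longrightarrow> represents C' s \<Longrightarrow> simulates P C T q s"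
  by (auto simp: simulates_def)

lemma simulates_prefix:
  assumes "(step P ^^ t) C = C'" "simulates P C' T q s"
  shows "simulates P C (t + T) q s"
proof -
  obtain t' where t': "t' \<le> T" "pc ((step P ^^ t') C') = q" "represents ((step P ^^ t') C') s"
    using assms(2) by (auto simp: simulates_def)
  have "(step P ^^ (t' + t)) C = (step P ^^ t') C'"
    using assms(1) by (simp add: funpow_add)
  then show ?thesis
    using t' by (intro simulatesI[where t = "t' + t"]) auto
qed

lemma simulates_weaken: "simulates P C T q s \<Longrightarrow> T \<le> T' \<Longrightarrow> simulates P C T' q s"
  by (auto simp: simulates_def intro: order_trans)

lemma simulates_straight:
  assumes "code_at P (pc C) is" "\<forall>i \<in> set is. straight i" "length is \<le> T"
    "represents (fold exec_instr is C) s"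
  shows "simulates P C T (pc C + length is) s"
proof -
  have "pc (fold exec_instr is C) = pc C + length is"
    using assms(2) by (induction "is" arbitrary: C) (auto simp: pc_exec_straight)
  then show ?thesis
    using assms(3,4) steps_straight[OF assms(1,2)] by (auto intro: simulatesI)
qed

lemma straight_opcode: "i \<in> set (opcode b r) \<Longrightarrow> straight i"
  by (cases b) auto

lemma length_opcode: "length (opcode b r) \<le> 2"
  by (cases b) auto

lemma exec_opcode:
  assumes "represents C s" "r = 29 \<or> r = 30"
  shows "fold exec_instr (opcode b r) C =
    C\<lparr>pc := pc C + length (opcode b r), regs := (regs C)(r := opval b s)\<rparr>"
proof (cases b)
  case (Reg x)
  then show ?thesis
    using assms cell_neq(9,10)[of x] by (auto simp: represents_def fun_eq_iff)
qed simp

lemma represents_pc: "represents (C\<lparr>pc := p\<rparr>) s = represents C s"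
  by (simp add: represents_def)

lemma represents_scratch:
  "represents C s \<Longrightarrow> r = 29 \<or> r = 30 \<or> r = 31 \<Longrightarrow>
    represents (C\<lparr>pc := p, regs := (regs C)(r := n)\<rparr>) s"
  by (auto simp: represents_def cell_neq)

lemma exec_addr_code:
  assumes "represents C s" "vs s x \<ge> 0"
  shows "\<exists>p n. fold exec_instr (addr_code a x) C =
    C\<lparr>pc := p, regs := (regs C)(30 := int (cell a (nat (vs s x))), 31 := n)\<rparr>"
proof (intro exI)
  have x: "regs C (vreg x) = vs s x"
    using assms by (simp add: represents_def)
  show "fold exec_instr (addr_code a x) C =
    C\<lparr>pc := pc C + 5, regs := (regs C)(30 := int (cell a (nat (vs s x))), 31 := 32 + int (areg a))\<rparr>"
    using assms(2) by (simp add: addr_code_def x cell_def fun_eq_iff)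
qed

lemma represents_set_var:
  "represents C s \<Longrightarrow> represents (C\<lparr>pc := p, regs := (regs C)(vreg x := n)\<rparr>) (set_var x n s)"
  by (auto simp: represents_def set_var_def cell_neq vreg_inj)

lemma represents_set_cell:
  "represents C s \<Longrightarrow> represents (C\<lparr>pc := p, regs := (regs C)(cell a i := n)\<rparr>) (set_cell a i n s)"
  by (auto simp: represents_def set_cell_def cell_neq cell_inj)

text \<open>The factor 9 covers the longest basic statement, 8 instructions for \<open>Put\<close>
  with a register operand, and the at most 3 instructions of control flow per test. \<open>P\<close>
  is any program containing the code at the current position, as the induction descends to
  subprograms.\<close>

lemma simulates_exec:
  assumes "exec c s t s'"
  shows "represents C s \<Longrightarrow> code_at P (pc C) (compile (pc C) c) \<Longrightarrow>
    simulates P C (9 * t) (pc C + csize c) s'"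
  using assms
proof (induction arbitrary: C rule: exec.induct)
  case (Skip s)
  then show ?case
    by (intro simulatesI[where t = 0]) auto
next
  case (Plus x a b s)
  let ?is = "compile (pc C) (Plus x a b)"
  obtain C1 where C1: "C1 = fold exec_instr (opcode a 29) C" by simp
  have r1: "represents C1 s"
    using Plus by (simp add: C1 exec_opcode represents_scratch)
  have "simulates P C (9 * 1) (pc C + length ?is) (set_var x (opval a s + opval b s) s)"
  proof (rule simulates_straight)
    have v: "regs C1 29 = opval a s"
      using Plus by (simp add: C1 exec_opcode)
    show "represents (fold exec_instr ?is C) (set_var x (opval a s + opval b s) s)"
      using v r1 represents_set_var[OF represents_scratch[OF r1, of 30]]
      by (simp add: C1[symmetric] exec_opcode[OF r1])
  qed (use Plus length_opcode[of a 29] length_opcode[of b 30] in \<open>auto dest: straight_opcode\<close>)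
  then show ?case
    by (simp only: length_compile)
next
  case (Minus x a b s)
  let ?is = "compile (pc C) (Minus x a b)"
  obtain C1 where C1: "C1 = fold exec_instr (opcode a 29) C" by simp
  have r1: "represents C1 s"
    using Minus by (simp add: C1 exec_opcode represents_scratch)
  have "simulates P C (9 * 1) (pc C + length ?is) (set_var x (opval a s - opval b s) s)"
  proof (rule simulates_straight)
    have v: "regs C1 29 = opval a s"
      using Minus by (simp add: C1 exec_opcode)
    show "represents (fold exec_instr ?is C) (set_var x (opval a s - opval b s) s)"
      using v r1 represents_set_var[OF represents_scratch[OF r1, of 30]]
      by (simp add: C1[symmetric] exec_opcode[OF r1])
  qed (use Minus length_opcode[of a 29] length_opcode[of b 30] in \<open>auto dest: straight_opcode\<close>)
  then show ?case
    by (simp only: length_compile)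
next
  case (Get s y x a)
  let ?is = "compile (pc C) (Get x a y)"
  obtain p n where C1: "fold exec_instr (addr_code a y) C =
      C\<lparr>pc := p, regs := (regs C)(30 := int (cell a (nat (vs s y))), 31 := n)\<rparr>" (is "_ = ?C1")
    using exec_addr_code Get by blast
  have r1: "represents ?C1 s"
    using Get represents_scratch[OF represents_scratch, of C s 30 31] by simp
  have c: "regs C (cell a i) = ar s a i" for a i
    using Get by (simp add: represents_def)
  have "simulates P C (9 * 1) (pc C + length ?is) (set_var x (ar s a (nat (vs s y))) s)"
  proof (rule simulates_straight)
    show "represents (fold exec_instr ?is C) (set_var x (ar s a (nat (vs s y))) s)"
      using represents_set_var[OF r1] by (simp add: C1 cell_neq c)
  qed (use Get in \<open>auto simp: addr_code_def\<close>)
  then show ?case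
    by (simp only: length_compile)
next
  case (Put s y a b)
  let ?is = "compile (pc C) (Put a y b)"
  obtain p n where C1: "fold exec_instr (addr_code a y) C =
      C\<lparr>pc := p, regs := (regs C)(30 := int (cell a (nat (vs s y))), 31 := n)\<rparr>" (is "_ = ?C1")
    using exec_addr_code Put by blast
  have r1: "represents ?C1 s"
    using Put represents_scratch[OF represents_scratch, of C s 30 31] by simp
  have "simulates P C (9 * 1) (pc C + length ?is) (set_cell a (nat (vs s y)) (opval b s) s)"
  proof (rule simulates_straight)
    show "represents (fold exec_instr ?is C) (set_cell a (nat (vs s y)) (opval b s) s)"
      using represents_set_cell[OF represents_scratch[OF r1, of 29]]
      by (simp add: C1 exec_opcode[OF r1])
  qed (use Put length_opcode[of b 29] in \<open>auto simp: addr_code_def dest: straight_opcode\<close>)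
  then show ?case
    by (simp only: length_compile)
next
  case (Input x s)
  have "simulates P C (9 * 1) (pc C + length (compile (pc C) (Input x)))
    ((set_var x (next_input (ip s)) s)\<lparr>ip := tl (ip s)\<rparr>)"
    using Input by (intro simulates_straight)
      (auto simp: represents_def next_input_def set_var_def cell_neq vreg_inj split: list.split)
  then show ?case
    by (simp only: length_compile)
next
  case (Seq c1 s t1 s1 c2 t2 s2)
  obtain t where t: "t \<le> 9 * t1" "pc ((step P ^^ t) C) = pc C + csize c1"
      "represents ((step P ^^ t) C) s1"
    using Seq.IH(1)[of C] Seq.prems by (auto simp: simulates_def code_at_append)
  have "simulates P ((step P ^^ t) C) (9 * t2) (pc C + csize c1 + csize c2) s2"
    using Seq.IH(2)[of "(step P ^^ t) C"] Seq.prems t by (simp add: code_at_append length_compile)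
  from simulates_prefix[OF refl this] show ?case
    using t(1) by (auto elim!: simulates_weaken simp: add.assoc)
next
  case (CondT s x c1 t s' c2)
  have "regs C (vreg x) > 0"
    using CondT by (simp add: represents_def)
  then have 1: "(step P ^^ 1) C = C\<lparr>pc := pc C + csize c2 + 3\<rparr>" (is "_ = ?C1")
    using CondT by (simp add: step_def halted_def)
  have "simulates P ?C1 (9 * t) (pc ?C1 + csize c1) s'"
    using CondT by (intro CondT.IH)
      (auto simp: represents_pc code_at_append length_compile eval_nat_numeral)
  from simulates_prefix[OF 1 this] show ?case
    by (auto elim!: simulates_weaken simp: ac_simps)
next
  case (CondF s x c2 t s' c1)
  have "\<not> regs C (vreg x) > 0"
    using CondF by (simp add: represents_def)
  then have 1: "(step P ^^ 1) C = C\<lparr>pc := pc C + 1\<rparr>" (is "_ = ?C1")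
    using CondF by (simp add: step_def halted_def)
  have "simulates P ?C1 (9 * t) (pc ?C1 + csize c2) s'"
    using CondF by (intro CondF.IH) (auto simp: represents_pc code_at_append)
  then obtain t' where t': "t' \<le> 9 * t" "pc ((step P ^^ t') ?C1) = pc ?C1 + csize c2"
      "represents ((step P ^^ t') ?C1) s'"
    by (auto simp: simulates_def)
  let ?C2 = "(step P ^^ t') ?C1"
  let ?C3 = "?C2\<lparr>pc := pc C + csize c2 + 3 + csize c1, regs := (regs ?C2)(31 := 1)\<rparr>"
  have "(step P ^^ 2) ?C2 = ?C3"
    using CondF.prems t'(2)
    by (simp add: step_def halted_def code_at_append length_compile eval_nat_numeral)
  then have "simulates P ?C2 2 (pc C + csize c2 + 3 + csize c1) s'"
    using represents_scratch[OF t'(3)] by (intro simulatesI[where t = 2]) auto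
  from simulates_prefix[OF refl this] have "simulates P ?C1 (t' + 2) (pc C + csize c2 + 3 + csize c1) s'" .
  from simulates_prefix[OF 1 this] show ?case
    using t'(1) by (auto elim!: simulates_weaken simp: ac_simps)
next
  case (LoopF s x b)
  have "\<not> regs C (vreg x) > 0"
    using LoopF by (simp add: represents_def)
  then have "(step P ^^ 3) C = C\<lparr>pc := pc C + csize b + 5, regs := (regs C)(31 := 1)\<rparr>"
    using LoopF by (simp add: step_def halted_def eval_nat_numeral)
  then show ?case
    by (rule simulatesI) (simp_all add: LoopF represents_scratch)
next
  case (LoopT s x b t1 s1 t2 s2)
  have "regs C (vreg x) > 0"
    using LoopT by (simp add: represents_def)
  then have 1: "(step P ^^ 1) C = C\<lparr>pc := pc C + 3\<rparr>" (is "_ = ?C1")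
    using LoopT by (simp add: step_def halted_def)
  have "simulates P ?C1 (9 * t1) (pc ?C1 + csize b) s1"
    using LoopT.prems by (intro LoopT.IH(1))
      (auto simp: represents_pc code_at_append eval_nat_numeral)
  then obtain t' where t': "t' \<le> 9 * t1" "pc ((step P ^^ t') ?C1) = pc ?C1 + csize b"
      "represents ((step P ^^ t') ?C1) s1"
    by (auto simp: simulates_def)
  let ?C2 = "(step P ^^ t') ?C1"
  let ?C3 = "?C2\<lparr>pc := pc C, regs := (regs ?C2)(31 := 1)\<rparr>"
  have 2: "(step P ^^ 2) ?C2 = ?C3"
    using LoopT.prems t'(2)
    by (simp add: step_def halted_def code_at_append length_compile eval_nat_numeral)
  have "simulates P ?C3 (9 * t2) (pc ?C3 + csize (Loop x b)) s2"
    using LoopT.prems represents_scratch[OF t'(3)] by (intro LoopT.IH(2)) auto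
  from simulates_prefix[OF 1 simulates_prefix[OF refl simulates_prefix[OF 2 this]]] show ?case
    using t'(1) by (auto elim!: simulates_weaken)
qed

definition initial_hstate :: "int list \<Rightarrow> hstate" where
  "initial_hstate zs = \<lparr>vs = \<lambda>_. 0, ar = \<lambda>_ _. 0, ip = zs\<rparr>"

text \<open>The simulation may stop earlier than the bound; a halted configuration then stays
  unchanged for the remaining steps.\<close>

lemma outputs_within_compile:
  assumes "exec c (initial_hstate zs) t s'"
  shows "outputs_within (compile 0 c) zs (9 * t) (vs s' RES)"
proof -
  let ?P = "compile 0 c" and ?C = "initial_config zs"
  have "represents ?C (initial_hstate zs)"
    by (simp add: represents_def initial_config_def initial_hstate_def)
  moreover have "code_at ?P (pc ?C) (compile (pc ?C) c)"
    using code_at_suffix[of "[]"] by (simp add: initial_config_def)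
  ultimately obtain t' where t': "t' \<le> 9 * t" "pc ((step ?P ^^ t') ?C) = csize c"
      "represents ((step ?P ^^ t') ?C) s'"
    using simulates_exec[OF assms, of ?C ?P] by (auto simp: simulates_def initial_config_def)
  have h: "halted ?P ((step ?P ^^ t') ?C)"
    using t'(2) by (simp add: halted_def length_compile)
  have "(step ?P ^^ d) ((step ?P ^^ t') ?C) = (step ?P ^^ t') ?C" for d
    using h by (induction d) (auto simp: step_def)
  from this[of "9 * t - t'"] have "(step ?P ^^ (9 * t)) ?C = (step ?P ^^ t') ?C"
    using t'(1) by (simp flip: funpow_add[THEN fun_cong, unfolded comp_def])
  moreover have "regs ((step ?P ^^ t') ?C) (vreg RES) = vs s' RES"
    using t'(3) unfolding represents_def by blast
  ultimately show ?thesis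
    using h by (simp add: outputs_within_def Let_def)
qed

section \<open>Reasoning about results, running time and unchanged memory\<close>

text \<open>A total correctness statement: existence of an execution includes termination, and the
  postcondition also sees the time. The equations below let the simplifier compute it as a weakest
  precondition.\<close>

definition run :: "cmd \<Rightarrow> hstate \<Rightarrow> (nat \<Rightarrow> hstate \<Rightarrow> bool) \<Rightarrow> bool" where
  "run c s Q \<longleftrightarrow> (\<exists>t s'. exec c s t s' \<and> Q t s')"

lemma exec_simps:
  "exec Skip s t s' \<longleftrightarrow> t = 1 \<and> s' = s"
  "exec (Plus x a b) s t s' \<longleftrightarrow> t = 1 \<and> s' = set_var x (opval a s + opval b s) s"
  "exec (Minus x a b) s t s' \<longleftrightarrow> t = 1 \<and> s' = set_var x (opval a s - opval b s) s"
  "exec (Get x d y) s t s' \<longleftrightarrow> vs s y \<ge> 0 \<and> t = 1 \<and> s' = set_var x (ar s d (nat (vs s y))) s"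
  "exec (Put d y b) s t s' \<longleftrightarrow> vs s y \<ge> 0 \<and> t = 1 \<and> s' = set_cell d (nat (vs s y)) (opval b s) s"
  "exec (Input x) s t s' \<longleftrightarrow> t = 1 \<and> s' = (set_var x (next_input (ip s)) s)\<lparr>ip := tl (ip s)\<rparr>"
  "exec (c1 ;; c2) s t s' \<longleftrightarrow> (\<exists>t1 s1 t2. exec c1 s t1 s1 \<and> exec c2 s1 t2 s' \<and> t = t1 + t2)"
  "exec (Cond x c1 c2) s t s' \<longleftrightarrow> (\<exists>t1. exec (if vs s x > 0 then c1 else c2) s t1 s' \<and> t = Suc t1)"
  by (subst exec.simps; auto)+

lemma exec_Loop:
  "exec (Loop x b) s t s' \<longleftrightarrow>
    (if vs s x > 0 then \<exists>t1 s1 t2. exec b s t1 s1 \<and> exec (Loop x b) s1 t2 s' \<and> t = Suc (t1 + t2)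
     else t = 1 \<and> s' = s)"
  by (subst exec.simps) auto

lemma run_simps:
  "run Skip s Q \<longleftrightarrow> Q 1 s"
  "run (Plus x a b) s Q \<longleftrightarrow> Q 1 (set_var x (opval a s + opval b s) s)"
  "run (Minus x a b) s Q \<longleftrightarrow> Q 1 (set_var x (opval a s - opval b s) s)"
  "run (Get x d y) s Q \<longleftrightarrow> vs s y \<ge> 0 \<and> Q 1 (set_var x (ar s d (nat (vs s y))) s)"
  "run (Put d y b) s Q \<longleftrightarrow> vs s y \<ge> 0 \<and> Q 1 (set_cell d (nat (vs s y)) (opval b s) s)"
  "run (Input x) s Q \<longleftrightarrow> Q 1 ((set_var x (next_input (ip s)) s)\<lparr>ip := tl (ip s)\<rparr>)"
  "run (c1 ;; c2) s Q \<longleftrightarrow> run c1 s (\<lambda>t1 s1. run c2 s1 (\<lambda>t2. Q (t1 + t2)))"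
  "run (Cond x c1 c2) s Q \<longleftrightarrow>
    (if vs s x > 0 then run c1 s (\<lambda>t. Q (Suc t)) else run c2 s (\<lambda>t. Q (Suc t)))"
  unfolding run_def exec_simps by auto metis+

lemma run_Loop:
  "run (Loop x b) s Q \<longleftrightarrow>
    (if vs s x > 0 then run b s (\<lambda>t1 s1. run (Loop x b) s1 (\<lambda>t2. Q (Suc (t1 + t2)))) else Q 1 s)"
  unfolding run_def by (subst exec_Loop) (auto, metis+)

fun writes_var :: "cmd \<Rightarrow> var \<Rightarrow> bool" where
  "writes_var (Plus x a b) y \<longleftrightarrow> y = x"
| "writes_var (Minus x a b) y \<longleftrightarrow> y = x"
| "writes_var (Get x a z) y \<longleftrightarrow> y = x"
| "writes_var (Input x) y \<longleftrightarrow> y = x"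
| "writes_var (c1 ;; c2) y \<longleftrightarrow> writes_var c1 y \<or> writes_var c2 y"
| "writes_var (Cond x c1 c2) y \<longleftrightarrow> writes_var c1 y \<or> writes_var c2 y"
| "writes_var (Loop x b) y \<longleftrightarrow> writes_var b y"
| "writes_var _ y \<longleftrightarrow> False"

fun writes_arr :: "cmd \<Rightarrow> arr \<Rightarrow> bool" where
  "writes_arr (Put a x b) d \<longleftrightarrow> d = a"
| "writes_arr (c1 ;; c2) d \<longleftrightarrow> writes_arr c1 d \<or> writes_arr c2 d"
| "writes_arr (Cond x c1 c2) d \<longleftrightarrow> writes_arr c1 d \<or> writes_arr c2 d"
| "writes_arr (Loop x b) d \<longleftrightarrow> writes_arr b d"
| "writes_arr _ d \<longleftrightarrow> False"

text \<open>A syntactic frame condition, attached to every composition rule, so that loop lemmas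
  mention only what they change.\<close>

definition frame :: "cmd \<Rightarrow> hstate \<Rightarrow> hstate \<Rightarrow> bool" where
  "frame c s s' \<longleftrightarrow> (\<forall>x. \<not> writes_var c x \<longrightarrow> vs s' x = vs s x) \<and>
     (\<forall>a. \<not> writes_arr c a \<longrightarrow> ar s' a = ar s a)"

lemma frame_exec: "exec c s t s' \<Longrightarrow> frame c s s'"
  by (induction rule: exec.induct) (auto simp: frame_def set_var_def set_cell_def)

lemma run_mono:
  "run c s Q \<Longrightarrow> (\<And>t s'. Q t s' \<Longrightarrow> frame c s s' \<Longrightarrow> Q' t s') \<Longrightarrow> run c s Q'"
  unfolding run_def using frame_exec by blast

lemma run_LoopI:
  assumes "vs s x > 0" "run b s Q1"
    "\<And>t1 s1. Q1 t1 s1 \<Longrightarrow> frame b s s1 \<Longrightarrow> run (Loop x b) s1 (\<lambda>t2. Q (Suc (t1 + t2)))"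
  shows "run (Loop x b) s Q"
  using assms(1) run_mono[OF assms(2)] assms(3) by (subst run_Loop) auto

lemma run_SeqI:
  assumes "run c1 s Q1"
    "\<And>t1 s1. Q1 t1 s1 \<Longrightarrow> frame c1 s s1 \<Longrightarrow> run c2 s1 (\<lambda>t2. Q (t1 + t2))"
  shows "run (c1 ;; c2) s Q"
  unfolding run_simps by (rule run_mono[OF assms(1)]) (rule assms(2))

lemma set_var_sel [simp]:
  "vs (set_var x n s) = (vs s)(x := n)" "ar (set_var x n s) = ar s" "ip (set_var x n s) = ip s"
  by (simp_all add: set_var_def)

lemma set_cell_sel [simp]:
  "vs (set_cell a i n s) = vs s" "ar (set_cell a i n s) = (ar s)(a := (ar s a)(i := n))"
  "ip (set_cell a i n s) = ip s"
  by (simp_all add: set_cell_def)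

lemma next_input_Cons [simp]: "next_input (z # zs) = z"
  by (simp add: next_input_def)

section \<open>The algorithm\<close>

abbreviation move :: "var \<Rightarrow> opnd \<Rightarrow> cmd" where
  "move x a \<equiv> Plus x a (Imm 0)"

abbreviation incr :: "var \<Rightarrow> cmd" where
  "incr x \<equiv> Plus x (Reg x) (Imm 1)"

abbreviation decr :: "var \<Rightarrow> cmd" where
  "decr x \<equiv> Minus x (Reg x) (Imm 1)"

text \<open>Variables get the codes 1, 2, 4, \<dots> in order of appearance. A left-hand side is thus identified
  by the sum of its codes, which serves as index into the array of merged coefficients.\<close>

definition read_var :: cmd where
  "read_var =
     Input CUR ;; Put Eqs PTR (Reg CUR) ;; incr PTR ;; Get TMP Code CUR ;;
     Cond TMP Skip (Put Code CUR (Reg POW) ;; move TMP (Reg POW) ;; Plus POW (Reg POW) (Reg POW)) ;;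
     Plus MASK (Reg MASK) (Reg TMP) ;; decr LEFT"

text \<open>Right-hand side 1 turns into a negative weight. The code sum is stored with the
  equation, so each marking pass finds the merged coefficient by one array access.\<close>

definition read_eq :: cmd where
  "read_eq =
     (Input LEFT ;; Put Eqs PTR (Reg LEFT) ;; incr PTR ;; move MASK (Imm 0)) ;;
     Loop LEFT read_var ;;
     Input TMP ;; Input WT ;; Cond TMP (Minus WT (Imm 0) (Reg WT)) Skip ;;
     Put Eqs PTR (Reg MASK) ;; incr PTR ;; Put Eqs PTR (Reg WT) ;; incr PTR ;;
     Get TMP Coef MASK ;; Plus TMP (Reg TMP) (Reg WT) ;; Put Coef MASK (Reg TMP) ;; decr EQS"

definition count_var :: cmd where
  "count_var =
     Get CUR Eqs PTR ;; Get TMP Mark CUR ;; incr FREE ;; Minus FREE (Reg FREE) (Reg TMP) ;;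
     incr PTR ;; decr LEFT"

definition mark_var :: cmd where
  "mark_var =
     Get CUR Eqs PTR2 ;; Get TMP Mark CUR ;;
     Cond TMP Skip (Put Mark CUR (Imm 1) ;; Put Order NVARS (Reg CUR) ;; incr NVARS) ;;
     incr PTR2 ;; decr LEFT2"

text \<open>\<open>FREE\<close> starts at 1, so that \<open>FREE - LEVEL > 0\<close> tests for at least \<open>LEVEL\<close> unmarked variables.\<close>

definition mark_eq :: cmd where
  "mark_eq =
     (Get LEFT Eqs PTR ;; incr PTR ;; move PTR2 (Reg PTR) ;; move LEFT2 (Reg LEFT) ;;
      move FREE (Imm 1)) ;;
     Loop LEFT count_var ;;
     (Get MASK Eqs PTR ;; Plus PTR (Reg PTR) (Imm 2) ;; Get TMP Coef MASK ;;
      Cond TMP Skip (Minus TMP (Imm 0) (Reg TMP)) ;; Minus FREE (Reg FREE) (Reg LEVEL)) ;;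
     Cond TMP (Cond FREE (Loop LEFT2 mark_var) Skip) Skip ;; decr EQS"

definition mark_level :: cmd where
  "mark_level = (move PTR (Imm 0) ;; move EQS (Reg NEQS)) ;; Loop EQS mark_eq ;; decr LEVEL"

definition eval_var :: cmd where
  "eval_var =
     Get CUR Eqs PTR ;; Get TMP Val CUR ;; Cond TMP (Minus PARITY (Imm 1) (Reg PARITY)) Skip ;;
     incr PTR ;; decr LEFT"

definition eval_eq :: cmd where
  "eval_eq =
     (Get LEFT Eqs PTR ;; incr PTR ;; move PARITY (Imm 0)) ;; Loop LEFT eval_var ;;
     incr PTR ;; Get WT Eqs PTR ;; incr PTR ;;
     Cond PARITY (Minus TOTAL (Reg TOTAL) (Reg WT)) (Plus TOTAL (Reg TOTAL) (Reg WT)) ;; decr EQS"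

text \<open>One digit of adding 1 to a binary counter: a 1 becomes 0 and the carry moves on, a 0
  becomes 1 and absorbs it. A carry past the last digit means that all assignments were tried, which
  clears \<open>GO\<close>.\<close>

definition carry_step :: cmd where
  "carry_step =
     Minus TMP (Reg NVARS) (Reg IDX) ;;
     Cond TMP
       (Get CUR Order IDX ;; Get TMP Val CUR ;;
        Cond TMP (Put Val CUR (Imm 0) ;; incr IDX) (Put Val CUR (Imm 1) ;; move CARRY (Imm 0)))
       (move CARRY (Imm 0) ;; move GO (Imm 0))"

text \<open>The increment of \<open>TMP\<close> turns the strict test into
  \<open>TOTAL \<ge> PARAM\<close>.\<close>

definition search_step :: cmd where
  "search_step =
     (move TOTAL (Imm 0) ;; move PTR (Imm 0) ;; move EQS (Reg NEQS)) ;; Loop EQS eval_eq ;;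
     (Minus TMP (Reg TOTAL) (Reg PARAM) ;; incr TMP) ;;
     Cond TMP (move RES (Imm 1) ;; move GO (Imm 0))
       ((move IDX (Imm 0) ;; move CARRY (Imm 1)) ;; Loop CARRY carry_step)"

text \<open>Repeated addition replaces the product of c(c+1)/2 and k - 1; the number of rounds
  depends on c only.\<close>

definition bound_step :: cmd where
  "bound_step = Plus BOUND (Reg BOUND) (Reg PARAM) ;; decr BOUND ;; decr TMP"

text \<open>All registers start at 0. Thus \<open>RES\<close> means no until it is set, and
  \<open>PTR\<close>, \<open>NVARS\<close>, \<open>BOUND\<close> and the first assignment have their
  initial values. For k = 0 the final \<open>BOUND\<close> is negative if c > 0, and the answer is
  yes at once.\<close>

definition solver :: "nat \<Rightarrow> cmd" where
  "solver c =
     (Input PARAM ;; Input NEQS ;; move POW (Imm 1) ;; move EQS (Reg NEQS)) ;; Loop EQS read_eq ;;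
     move LEVEL (Imm (int c)) ;; Loop LEVEL mark_level ;;
     move TMP (Imm (int (c * (c + 1) div 2))) ;; Loop TMP bound_step ;;
     Minus TMP (Reg NVARS) (Reg BOUND) ;;
     Cond TMP (move RES (Imm 1)) (move GO (Imm 1) ;; Loop GO search_step)"

section \<open>Reading the system and merging equal left-hand sides\<close>

fun stored :: "(nat \<Rightarrow> int) \<Rightarrow> nat \<Rightarrow> int list \<Rightarrow> bool" where
  "stored M p [] \<longleftrightarrow> True"
| "stored M p (z # zs) \<longleftrightarrow> M p = z \<and> stored M (Suc p) zs"

lemma stored_append: "stored M p (xs @ ys) \<longleftrightarrow> stored M p xs \<and> stored M (p + length xs) ys"
  by (induction xs arbitrary: p) auto

lemma stored_cong:
  "stored M p zs \<Longrightarrow> (\<And>i. p \<le> i \<Longrightarrow> i < p + length zs \<Longrightarrow> M' i = M i) \<Longrightarrow> stored M' p zs"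
  by (induction zs arbitrary: p) auto

text \<open>A positive entry means that the variable has a code, and \<open>b\<close> is the next
  code. The invariant records only what powers of two are for: subset sums are distinct and below
  \<open>b\<close>.\<close>

definition table :: "(nat \<Rightarrow> int) \<Rightarrow> int \<Rightarrow> bool" where
  "table T b \<longleftrightarrow> (\<forall>v. T v \<ge> 0) \<and> finite {v. T v > 0} \<and> (\<Sum>v | T v > 0. T v) < b \<and>
     inj_on (\<lambda>X. \<Sum>v\<in>X. T v) (Pow {v. T v > 0})"

text \<open>Sums without \<open>v\<close> lie in [0, b) and sums with \<open>v\<close> in [b, 2b),
  so the two kinds cannot collide and each remains injective.\<close>

lemma table_insert:
  assumes "table T b" "\<not> T v > 0"
  shows "table (T(v := b)) (b + b)"
proof -
  let ?S = "{v. T v > 0}" and ?T = "T(v := b)"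
  have T: "\<And>v. T v \<ge> 0" "finite ?S" "sum T ?S < b" "inj_on (\<lambda>X. \<Sum>v\<in>X. T v) (Pow ?S)"
    using assms by (auto simp: table_def)
  have b: "b > 0"
    using T(3) sum_nonneg[of ?S T] T(1) by force
  have S': "{w. ?T w > 0} = insert v ?S" "v \<notin> ?S"
    using b assms(2) by auto
  have eq: "sum ?T X = sum T (X - {v}) + (if v \<in> X then b else 0)" if "X \<subseteq> insert v ?S" for X
  proof -
    have "finite X"
      using that T(2) finite_subset by blast
    moreover have "sum ?T (X - {v}) = sum T (X - {v})"
      by (intro sum.cong) auto
    ultimately show ?thesis
      using sum.remove[of X v ?T] by (cases "v \<in> X") (simp_all del: fun_upd_apply add: fun_upd_same)
  qed
  have less: "0 \<le> sum T (X - {v}) \<and> sum T (X - {v}) < b" if "X \<subseteq> insert v ?S" for X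
  proof -
    have "sum T (X - {v}) \<le> sum T ?S"
      using that T(1,2) by (intro sum_mono2) auto
    then show ?thesis
      using T(1,3) by (auto intro: sum_nonneg)
  qed
  have "inj_on (\<lambda>X. sum ?T X) (Pow (insert v ?S))"
  proof (rule inj_onI)
    fix X Y assume XY: "X \<in> Pow (insert v ?S)" "Y \<in> Pow (insert v ?S)" "sum ?T X = sum ?T Y"
    then have v: "v \<in> X \<longleftrightarrow> v \<in> Y" "sum T (X - {v}) = sum T (Y - {v})"
      using eq[of X] eq[of Y] less[of X] less[of Y] by (auto split: if_splits)
    have "X - {v} = Y - {v}"
      using XY by (intro inj_onD[OF T(4) v(2)]) auto
    then show "X = Y"
      using v(1) by blast
  qed
  moreover have "sum ?T (insert v ?S) < b + b"
    using eq[of "insert v ?S"] less[of "insert v ?S"] by simp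
  moreover have "\<forall>w. ?T w \<ge> 0"
    using T(1) b by simp
  ultimately show ?thesis
    unfolding table_def S' using T(2) by (simp del: fun_upd_apply)
qed

text \<open>Codes once assigned never change, so code sums stored earlier stay valid.\<close>

definition extends :: "(nat \<Rightarrow> int) \<Rightarrow> (nat \<Rightarrow> int) \<Rightarrow> bool" where
  "extends T' T \<longleftrightarrow> (\<forall>v. T v > 0 \<longrightarrow> T' v = T v)"

definition mask :: "(nat \<Rightarrow> int) \<Rightarrow> nat list \<Rightarrow> int" where
  "mask T xs = (\<Sum>v\<leftarrow>xs. T v)"

lemma mask_extends: "extends T' T \<Longrightarrow> \<forall>v\<in>set xs. T v > 0 \<Longrightarrow> mask T' xs = mask T xs"
  by (induction xs) (auto simp: mask_def extends_def)

lemma mask_nonneg: "(\<And>v. T v \<ge> 0) \<Longrightarrow> mask T xs \<ge> 0"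
  by (induction xs) (auto simp: mask_def)

lemma mask_eq_iff:
  assumes "table T b" "distinct xs" "distinct ys" "\<forall>v\<in>set xs. T v > 0" "\<forall>v\<in>set ys. T v > 0"
  shows "nat (mask T xs) = nat (mask T ys) \<longleftrightarrow> set xs = set ys"
proof -
  have "mask T xs = sum T (set xs)" "mask T ys = sum T (set ys)"
    using assms(2,3) by (simp_all add: mask_def sum_list_distinct_conv_sum_set)
  moreover have "mask T xs \<ge> 0" "mask T ys \<ge> 0"
    using assms(1) by (auto simp: table_def intro: mask_nonneg)
  moreover have "inj_on (sum T) (Pow {v. T v > 0})"
    using assms(1) by (simp add: table_def)
  ultimately show ?thesis
    using assms(4,5) by (auto dest: inj_onD[where x = "set xs" and y = "set ys"])
qed

lemma run_read_vars:
  assumes "vs s LEFT = int (length ys)" "ip s = map int ys @ zs" "vs s PTR = int p"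
    "table (ar s Code) (vs s POW)"
  shows "run (Loop LEFT read_var) s (\<lambda>t s'. t \<le> 12 * length ys + 1 \<and>
    vs s' PTR = int (p + length ys) \<and> ip s' = zs \<and> stored (ar s' Eqs) p (map int ys) \<and>
    (\<forall>i<p. ar s' Eqs i = ar s Eqs i) \<and> table (ar s' Code) (vs s' POW) \<and>
    extends (ar s' Code) (ar s Code) \<and> (\<forall>v\<in>set ys. ar s' Code v > 0) \<and>
    vs s' MASK = vs s MASK + mask (ar s' Code) ys)"
  using assms
proof (induction ys arbitrary: s p)
  case Nil
  then show ?case
    by (subst run_Loop) (simp add: extends_def mask_def)
next
  case (Cons y ys)
  show ?case (is "run _ _ ?Q")
  proof (rule run_LoopI)
    show "vs s LEFT > 0"
      using Cons.prems by simp
    show "run read_var s (\<lambda>t s1. t \<le> 11 \<and> vs s1 LEFT = int (length ys) \<and> ip s1 = map int ys @ zs \<and>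
      vs s1 PTR = int (Suc p) \<and> table (ar s1 Code) (vs s1 POW) \<and> extends (ar s1 Code) (ar s Code) \<and>
      ar s1 Eqs = (ar s Eqs)(p := int y) \<and> ar s1 Code y > 0 \<and> vs s1 MASK = vs s MASK + ar s1 Code y)"
      (is "run _ _ ?R")
    proof (cases "ar s Code y > 0")
      case True
      then show ?thesis
        using Cons.prems by (simp add: read_var_def run_simps extends_def)
    next
      case False
      \<comment> \<open>Subset sums are nonnegative and below \<open>POW\<close>. Positivity makes
        the new entry count as assigned.\<close>
      have "vs s POW > 0"
        using Cons.prems(4) sum_nonneg[of "{v. ar s Code v > 0}" "ar s Code"]
        by (force simp: table_def)
      then show ?thesis
        using False Cons.prems table_insert[OF Cons.prems(4) False]
        by (simp add: read_var_def run_simps extends_def)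
    qed
    fix t1 s1 assume 1: "?R t1 s1"
    show "run (Loop LEFT read_var) s1 (\<lambda>t2. ?Q (Suc (t1 + t2)))"
      by (rule run_mono[OF Cons.IH[where p = "Suc p"]])
        (use 1 in \<open>auto simp: extends_def mask_def\<close>)
  qed
qed

text \<open>The right-hand side is the sign of the coefficient; nothing is lost as weights are
  positive.\<close>

fun input_code :: "nat list \<times> int \<Rightarrow> int list" where
  "input_code (xs, a) = int (length xs) # map int xs @ [of_bool (a < 0), \<bar>a\<bar>]"

fun eq_code :: "(nat \<Rightarrow> int) \<Rightarrow> nat list \<times> int \<Rightarrow> int list" where
  "eq_code T (xs, a) = int (length xs) # map int xs @ [mask T xs, a]"

text \<open>All code sums refer to the final table, although they were formed while it was still
  growing; \<open>mask_extends\<close> reconciles the two.\<close>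

lemma run_read_eqs:
  assumes "vs s EQS = int (length us)" "ip s = concat (map input_code us)" "vs s PTR = int p"
    "table (ar s Code) (vs s POW)" "\<forall>(xs, a)\<in>set us. length xs \<le> c"
  shows "run (Loop EQS read_eq) s (\<lambda>t s'. t \<le> (12 * c + 25) * length us + 1 \<and>
    stored (ar s' Eqs) p (concat (map (eq_code (ar s' Code)) us)) \<and>
    (\<forall>i<p. ar s' Eqs i = ar s Eqs i) \<and> table (ar s' Code) (vs s' POW) \<and>
    extends (ar s' Code) (ar s Code) \<and> (\<forall>(xs, a)\<in>set us. \<forall>v\<in>set xs. ar s' Code v > 0) \<and>
    (\<forall>i. ar s' Coef i = ar s Coef i +
      (\<Sum>(xs, a)\<leftarrow>us. if nat (mask (ar s' Code) xs) = i then a else 0)))"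
  using assms
proof (induction us arbitrary: s p)
  case Nil
  then show ?case
    by (subst run_Loop) (simp add: extends_def)
next
  case (Cons u us)
  obtain xs a where u: "u = (xs, a)"
    by (cases u)
  let ?q = "p + length xs + 3"
  show ?case (is "run _ _ ?Q")
  proof (rule run_LoopI)
    show "vs s EQS > 0"
      using Cons.prems by simp
    show "run read_eq s (\<lambda>t s1. t \<le> 12 * c + 24 \<and> vs s1 EQS = int (length us) \<and>
      ip s1 = concat (map input_code us) \<and> vs s1 PTR = int ?q \<and> table (ar s1 Code) (vs s1 POW) \<and>
      extends (ar s1 Code) (ar s Code) \<and> stored (ar s1 Eqs) p (eq_code (ar s1 Code) u) \<and>
      (\<forall>i<p. ar s1 Eqs i = ar s Eqs i) \<and> (\<forall>v\<in>set xs. ar s1 Code v > 0) \<and>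
      (\<forall>i. ar s1 Coef i = ar s Coef i + (if nat (mask (ar s1 Code) xs) = i then a else 0)))"
      (is "run _ _ ?R")
      unfolding read_eq_def
    proof (rule run_SeqI, goal_cases)
      show "run (Input LEFT ;; Put Eqs PTR (Reg LEFT) ;; incr PTR ;; move MASK (Imm 0)) s
        (\<lambda>t s1. t = 4 \<and> vs s1 LEFT = int (length xs) \<and> vs s1 PTR = int (Suc p) \<and>
          vs s1 MASK = 0 \<and> ip s1 = map int xs @ of_bool (a < 0) # \<bar>a\<bar> # concat (map input_code us) \<and>
          ar s1 = (ar s)(Eqs := (ar s Eqs)(p := int (length xs))) \<and> vs s1 POW = vs s POW \<and>
          vs s1 EQS = vs s EQS)"
        (is "run _ _ ?R1")
        using Cons.prems by (simp add: run_simps u)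
      fix t1 s1 assume 1: "?R1 t1 s1"
      show "run (Loop LEFT read_var ;; Input TMP ;; Input WT ;; Cond TMP (Minus WT (Imm 0) (Reg WT)) Skip ;;
        Put Eqs PTR (Reg MASK) ;; incr PTR ;; Put Eqs PTR (Reg WT) ;; incr PTR ;;
        Get TMP Coef MASK ;; Plus TMP (Reg TMP) (Reg WT) ;; Put Coef MASK (Reg TMP) ;; decr EQS) s1
        (\<lambda>t2. ?R (t1 + t2))"
      proof (rule run_SeqI, rule run_read_vars)
        fix t2 s2
        assume 2: "t2 \<le> 12 * length xs + 1 \<and> vs s2 PTR = int (Suc p + length xs) \<and>
          ip s2 = of_bool (a < 0) # \<bar>a\<bar> # concat (map input_code us) \<and>
          stored (ar s2 Eqs) (Suc p) (map int xs) \<and> (\<forall>i<Suc p. ar s2 Eqs i = ar s1 Eqs i) \<and>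
          table (ar s2 Code) (vs s2 POW) \<and> extends (ar s2 Code) (ar s1 Code) \<and>
          (\<forall>v\<in>set xs. ar s2 Code v > 0) \<and> vs s2 MASK = vs s1 MASK + mask (ar s2 Code) xs"
          and f: "frame (Loop LEFT read_var) s1 s2"
        have fr: "vs s2 EQS = vs s1 EQS" "ar s2 Coef = ar s1 Coef"
          using f by (simp_all add: frame_def read_var_def)
        have m: "mask (ar s2 Code) xs \<ge> 0"
          using 2 by (auto simp: table_def intro: mask_nonneg)
        obtain q where q: "q = Suc (p + length xs)"
          by simp
        \<comment> \<open>Code sum and weight are written directly behind the indices and leave them
          intact.\<close>
        have st: "stored (M(q := y, Suc q := z)) (Suc p) (map int xs)"
          if "stored M (Suc p) (map int xs)" for M y z
          by (rule stored_cong[OF that]) (auto simp: q)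
        have ptr: "vs s2 PTR = int q" "int ?q = int q + 2"
          using 2 by (simp_all add: q)
        have Q: "p + length (map int xs) = q - 1" "Suc p + length (map int xs) = q" "p < q"
          by (simp_all add: q)
        have len: "length xs \<le> c"
          using Cons.prems u by simp
        show "run (Input TMP ;; Input WT ;; Cond TMP (Minus WT (Imm 0) (Reg WT)) Skip ;;
          Put Eqs PTR (Reg MASK) ;; incr PTR ;; Put Eqs PTR (Reg WT) ;; incr PTR ;;
          Get TMP Coef MASK ;; Plus TMP (Reg TMP) (Reg WT) ;; Put Coef MASK (Reg TMP) ;; decr EQS) s2
          (\<lambda>t3. ?R (t1 + (t2 + t3)))"
          unfolding ptr(2) u eq_code.simps stored.simps stored_append Q
          using 1 2 fr m len Cons.prems(1) Q(3) st
          by (cases "a < 0") (simp_all add: run_simps ptr(1) nat_add_distrib del: of_nat_add of_nat_Suc)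
      qed (use 1 Cons.prems in auto)
    qed
    fix t1 s1 assume 1: "?R t1 s1"
    show "run (Loop EQS read_eq) s1 (\<lambda>t2. ?Q (Suc (t1 + t2)))"
    proof (rule run_mono[OF Cons.IH[where p = "?q"]])
      fix t2 and s2 :: hstate
      assume 2: "t2 \<le> (12 * c + 25) * length us + 1 \<and>
        stored (ar s2 Eqs) ?q (concat (map (eq_code (ar s2 Code)) us)) \<and>
        (\<forall>i<?q. ar s2 Eqs i = ar s1 Eqs i) \<and> table (ar s2 Code) (vs s2 POW) \<and>
        extends (ar s2 Code) (ar s1 Code) \<and> (\<forall>(xs, a)\<in>set us. \<forall>v\<in>set xs. ar s2 Code v > 0) \<and>
        (\<forall>i. ar s2 Coef i = ar s1 Coef i +
          (\<Sum>(xs, a)\<leftarrow>us. if nat (mask (ar s2 Code) xs) = i then a else 0))"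
      have m: "mask (ar s2 Code) xs = mask (ar s1 Code) xs"
        using 1 2 by (intro mask_extends) auto
      have "stored (ar s2 Eqs) p (eq_code (ar s1 Code) u)"
      proof (rule stored_cong[of "ar s1 Eqs"])
        show "stored (ar s1 Eqs) p (eq_code (ar s1 Code) u)"
          using 1 by blast
        fix i assume "p \<le> i" "i < p + length (eq_code (ar s1 Code) u)"
        then show "ar s2 Eqs i = ar s1 Eqs i"
          using 2 by (simp add: u)
      qed
      then have st: "stored (ar s2 Eqs) p (concat (map (eq_code (ar s2 Code)) (u # us)))"
        using 2 by (simp add: u m stored_append eval_nat_numeral)
      have co: "\<forall>i. ar s2 Coef i = ar s Coef i +
          (\<Sum>(xs, a)\<leftarrow>u # us. if nat (mask (ar s2 Code) xs) = i then a else 0)"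
        using 1 2 by (simp add: u m)
      have ex: "extends (ar s2 Code) (ar s Code)" "\<forall>(xs, a)\<in>set (u # us). \<forall>v\<in>set xs. ar s2 Code v > 0"
        using 1 2 by (auto simp: extends_def u)
      have eq: "\<forall>i<p. ar s2 Eqs i = ar s Eqs i"
        using 1 2 by simp
      have ti: "Suc (t1 + t2) \<le> (12 * c + 25) * length (u # us) + 1"
        using 1 2 by simp
      have ta: "table (ar s2 Code) (vs s2 POW)"
        using 2 by blast
      show "?Q (Suc (t1 + t2)) s2"
        by (intro conjI st co ex eq ti ta)
    next
      show "vs s1 EQS = int (length us)" "ip s1 = concat (map input_code us)" "vs s1 PTR = int ?q"
        "table (ar s1 Code) (vs s1 POW)"
        using 1 by blast+
      show "\<forall>(xs, a)\<in>set us. length xs \<le> c"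
        using Cons.prems(5) by simp
    qed
  qed
qed

section \<open>Marking on the machine\<close>

lemma run_count_vars:
  assumes "vs s LEFT = int (length ys)" "vs s PTR = int p" "stored (ar s Eqs) p (map int ys)"
    "ar s Mark = (\<lambda>v. of_bool (v \<in> V))"
  shows "run (Loop LEFT count_var) s (\<lambda>t s'. t \<le> 7 * length ys + 1 \<and>
    vs s' PTR = int (p + length ys) \<and> vs s' FREE = vs s FREE + int (length (filter (\<lambda>v. v \<notin> V) ys)))"
  using assms
proof (induction ys arbitrary: s p)
  case Nil
  then show ?case
    by (subst run_Loop) simp
next
  case (Cons y ys)
  show ?case (is "run _ _ ?Q")
  proof (rule run_LoopI)
    show "vs s LEFT > 0"
      using Cons.prems by simp
    show "run count_var s (\<lambda>t s1. t = 6 \<and> vs s1 LEFT = int (length ys) \<and> vs s1 PTR = int (Suc p) \<and>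
        vs s1 FREE = vs s FREE + of_bool (y \<notin> V) \<and> ar s1 = ar s)" (is "run _ _ ?R")
      using Cons.prems by (simp add: count_var_def run_simps)
    fix t1 and s1 :: hstate assume 1: "?R t1 s1"
    show "run (Loop LEFT count_var) s1 (\<lambda>t2. ?Q (Suc (t1 + t2)))"
      by (rule run_mono[OF Cons.IH[where p = "Suc p"]]) (use 1 Cons.prems in auto)
  qed
qed

text \<open>The indicator gives a membership test in constant time, the list fixes the digits of the
  later binary counter.\<close>

definition marked :: "hstate \<Rightarrow> nat set \<Rightarrow> bool" where
  "marked s V \<longleftrightarrow> ar s Mark = (\<lambda>v. of_bool (v \<in> V)) \<and>
     (\<exists>l. distinct l \<and> set l = V \<and> vs s NVARS = int (length l) \<and> stored (ar s Order) 0 (map int l))"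

lemma marked_cong:
  "marked s V \<Longrightarrow> ar s' Mark = ar s Mark \<Longrightarrow> ar s' Order = ar s Order \<Longrightarrow> vs s' NVARS = vs s NVARS \<Longrightarrow>
    marked s' V"
  by (simp add: marked_def)

lemma marked_insert:
  assumes "marked s V" "y \<notin> V" "ar s' Mark = (ar s Mark)(y := 1)"
    "ar s' Order = (ar s Order)(nat (vs s NVARS) := int y)" "vs s' NVARS = vs s NVARS + 1"
  shows "vs s NVARS \<ge> 0 \<and> marked s' (insert y V)"
proof -
  obtain l where l: "distinct l" "set l = V" "vs s NVARS = int (length l)" "stored (ar s Order) 0 (map int l)"
    using assms(1) by (auto simp: marked_def)
  have "stored (ar s' Order) 0 (map int (l @ [y]))"
    using l assms(4) by (auto simp: stored_append intro: stored_cong[OF l(4)])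
  moreover have "ar s' Mark = (\<lambda>v. of_bool (v \<in> insert y V))"
    using assms(1,3) by (auto simp: marked_def fun_eq_iff)
  ultimately show ?thesis
    unfolding marked_def using l assms(2,5) by (intro conjI exI[of _ "l @ [y]"]) auto
qed

lemma run_mark_vars:
  assumes "vs s LEFT2 = int (length ys)" "vs s PTR2 = int p" "stored (ar s Eqs) p (map int ys)"
    "marked s V"
  shows "run (Loop LEFT2 mark_var) s (\<lambda>t s'. t \<le> 10 * length ys + 1 \<and> marked s' (V \<union> set ys))"
  using assms
proof (induction ys arbitrary: s p V)
  case Nil
  then show ?case
    by (subst run_Loop) simp
next
  case (Cons y ys)
  show ?case (is "run _ _ ?Q")
  proof (rule run_LoopI)
    show "vs s LEFT2 > 0"
      using Cons.prems by simp
    have mark: "ar s Mark = (\<lambda>v. of_bool (v \<in> V))"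
      using Cons.prems by (simp add: marked_def)
    show "run mark_var s (\<lambda>t s1. t \<le> 8 \<and> vs s1 LEFT2 = int (length ys) \<and> vs s1 PTR2 = int (Suc p) \<and>
        ar s1 Eqs = ar s Eqs \<and> marked s1 (insert y V))" (is "run _ _ ?R")
    proof (cases "y \<in> V")
      case True
      then show ?thesis
        using Cons.prems by (auto simp: mark_var_def run_simps mark insert_absorb elim!: marked_cong)
    next
      case False
      have "vs s NVARS \<ge> 0"
        using Cons.prems by (auto simp: marked_def)
      moreover have "y \<notin> V \<Longrightarrow> ar s' Mark = (ar s Mark)(y := 1) \<Longrightarrow>
          ar s' Order = (ar s Order)(nat (vs s NVARS) := int y) \<Longrightarrow> vs s' NVARS = vs s NVARS + 1 \<Longrightarrow>
          marked s' (insert y V)" for s'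
        using marked_insert[OF Cons.prems(4)] by blast
      ultimately show ?thesis
        using False Cons.prems(1-3) by (simp add: mark_var_def run_simps mark)
    qed
    fix t1 and s1 :: hstate assume 1: "?R t1 s1"
    show "run (Loop LEFT2 mark_var) s1 (\<lambda>t2. ?Q (Suc (t1 + t2)))"
      by (rule run_mono[OF Cons.IH[where p = "Suc p" and V = "insert y V"]])
        (use 1 Cons.prems in auto)
  qed
qed

lemma length_filter_notin: "distinct xs \<Longrightarrow> length (filter (\<lambda>v. v \<notin> V) xs) = card (set xs - V)"
  by (simp add: distinct_length_filter Int_commute Collect_neg_eq Diff_eq)

text \<open>The last hypothesis identifies a nonzero array cell with membership in
  \<open>Act\<close>, which makes the loop an execution of
  \<open>fold (mark_step Act j)\<close>.\<close>

lemma run_mark_eqs: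
  assumes "vs s EQS = int (length us)" "vs s PTR = int p" "vs s LEVEL = int j"
    "stored (ar s Eqs) p (concat (map (eq_code T) us))" "\<And>v. T v \<ge> 0" "marked s V"
    "\<forall>(xs, a)\<in>set us. distinct xs \<and> length xs \<le> c \<and>
      (ar s Coef (nat (mask T xs)) \<noteq> 0 \<longleftrightarrow> set xs \<in> Act)"
  shows "run (Loop EQS mark_eq) s (\<lambda>t s'. t \<le> (17 * c + 20) * length us + 1 \<and>
    marked s' (fold (mark_step Act j) us V))"
  using assms
proof (induction us arbitrary: s p V)
  case Nil
  then show ?case
    by (subst run_Loop) simp
next
  case (Cons u us)
  obtain xs a where u: "u = (xs, a)"
    by (cases u)
  let ?q = "p + length xs + 3"
  have xs: "distinct xs" "length xs \<le> c" "ar s Coef (nat (mask T xs)) \<noteq> 0 \<longleftrightarrow> set xs \<in> Act"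
    using Cons.prems(7) u by auto
  have st: "ar s Eqs p = int (length xs)" "stored (ar s Eqs) (Suc p) (map int xs)"
      "ar s Eqs (Suc (p + length xs)) = mask T xs"
      "stored (ar s Eqs) ?q (concat (map (eq_code T) us))"
    using Cons.prems(4) by (simp_all add: u stored_append eval_nat_numeral)
  show ?case (is "run _ _ ?Q")
  proof (rule run_LoopI)
    show "vs s EQS > 0"
      using Cons.prems by simp
    show "run mark_eq s (\<lambda>t s1. t \<le> 17 * c + 19 \<and> vs s1 EQS = int (length us) \<and> vs s1 PTR = int ?q \<and>
        marked s1 (mark_step Act j u V))" (is "run _ _ ?R")
      unfolding mark_eq_def
    proof (rule run_SeqI)
      show "run (Get LEFT Eqs PTR ;; incr PTR ;; move PTR2 (Reg PTR) ;; move LEFT2 (Reg LEFT) ;;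
          move FREE (Imm 1)) s (\<lambda>t s1. t = 5 \<and> vs s1 LEFT = int (length xs) \<and>
          vs s1 LEFT2 = int (length xs) \<and> vs s1 PTR = int (Suc p) \<and> vs s1 PTR2 = int (Suc p) \<and>
          vs s1 FREE = 1 \<and> ar s1 = ar s \<and> vs s1 NVARS = vs s NVARS \<and> vs s1 EQS = vs s EQS \<and>
          vs s1 LEVEL = int j)" (is "run _ _ ?R1")
        using Cons.prems st by (simp add: run_simps)
      fix t1 and s1 :: hstate assume 1: "?R1 t1 s1"
      show "run (Loop LEFT count_var ;;
         (Get MASK Eqs PTR ;; Plus PTR (Reg PTR) (Imm 2) ;; Get TMP Coef MASK ;;
          Cond TMP Skip (Minus TMP (Imm 0) (Reg TMP)) ;; Minus FREE (Reg FREE) (Reg LEVEL)) ;;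
         Cond TMP (Cond FREE (Loop LEFT2 mark_var) Skip) Skip ;; decr EQS) s1 (\<lambda>t2. ?R (t1 + t2))"
      proof (rule run_SeqI[OF run_count_vars[where p = "Suc p" and V = V]])
        fix t2 and s2 :: hstate
        assume 2: "t2 \<le> 7 * length xs + 1 \<and> vs s2 PTR = int (Suc p + length xs) \<and>
            vs s2 FREE = vs s1 FREE + int (length (filter (\<lambda>v. v \<notin> V) xs))"
          and "frame (Loop LEFT count_var) s1 s2"
        then have fr: "ar s2 = ar s" "vs s2 LEFT2 = int (length xs)" "vs s2 PTR2 = int (Suc p)"
            "vs s2 NVARS = vs s NVARS" "vs s2 EQS = vs s EQS" "vs s2 LEVEL = int j"
          using 1 by (auto simp: frame_def count_var_def fun_eq_iff)
        have free: "vs s2 FREE = 1 + int (card (set xs - V))"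
          using 1 2 xs by (simp add: length_filter_notin)
        show "run ((Get MASK Eqs PTR ;; Plus PTR (Reg PTR) (Imm 2) ;; Get TMP Coef MASK ;;
            Cond TMP Skip (Minus TMP (Imm 0) (Reg TMP)) ;; Minus FREE (Reg FREE) (Reg LEVEL)) ;;
          Cond TMP (Cond FREE (Loop LEFT2 mark_var) Skip) Skip ;; decr EQS) s2
          (\<lambda>t3. ?R (t1 + (t2 + t3)))"
        proof (rule run_SeqI)
          \<comment> \<open>After the conditional negation \<open>TMP\<close> is the absolute value
            of the coefficient, so its positivity tests for a nonzero coefficient.\<close>
          show "run (Get MASK Eqs PTR ;; Plus PTR (Reg PTR) (Imm 2) ;; Get TMP Coef MASK ;;
              Cond TMP Skip (Minus TMP (Imm 0) (Reg TMP)) ;; Minus FREE (Reg FREE) (Reg LEVEL)) s2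
            (\<lambda>t s3. t \<le> 6 \<and> ar s3 = ar s \<and> vs s3 LEFT2 = int (length xs) \<and> vs s3 PTR2 = int (Suc p) \<and>
              vs s3 PTR = int ?q \<and> vs s3 NVARS = vs s NVARS \<and> vs s3 EQS = vs s EQS \<and>
              (vs s3 TMP > 0 \<longleftrightarrow> set xs \<in> Act) \<and> (vs s3 FREE > 0 \<longleftrightarrow> j \<le> card (set xs - V)))"
            (is "run _ _ ?R3")
            using 2 fr free st xs(3) mask_nonneg[of T xs, OF Cons.prems(5)]
            by (auto simp: run_simps nat_add_distrib)
          fix t3 and s3 :: hstate assume 3: "?R3 t3 s3"
          have mk: "marked s3 V"
            using Cons.prems(6) 3 by (auto elim: marked_cong)
          show "run (Cond TMP (Cond FREE (Loop LEFT2 mark_var) Skip) Skip ;; decr EQS) s3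
            (\<lambda>t4. ?R (t1 + (t2 + (t3 + t4))))"
          proof (cases "set xs \<in> Act \<and> j \<le> card (set xs - V)")
            case True
            \<comment> \<open>The two successors pay for the nested tests, the added 1 for the final
              decrement of \<open>EQS\<close>.\<close>
            have "run (Loop LEFT2 mark_var) s3 (\<lambda>t4 s4. ?R (t1 + (t2 + (t3 + (Suc (Suc t4) + 1))))
                (set_var EQS (vs s4 EQS - 1) s4))"
            proof (rule run_mono[OF run_mark_vars[where p = "Suc p" and V = V and ys = xs]])
              fix t4 and s4 :: hstate
              assume 4: "t4 \<le> 10 * length xs + 1 \<and> marked s4 (V \<union> set xs)"
                and "frame (Loop LEFT2 mark_var) s3 s4"
              then have "vs s4 PTR = vs s3 PTR" "vs s4 EQS = vs s3 EQS"
                by (auto simp: frame_def mark_var_def)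
              then show "?R (t1 + (t2 + (t3 + (Suc (Suc t4) + 1)))) (set_var EQS (vs s4 EQS - 1) s4)"
                using 1 2 3 4 True xs(2) Cons.prems(1)
                by (auto simp: u mark_step_def elim: marked_cong)
            qed (use 3 st mk in auto)
            then show ?thesis
              using 3 True by (simp add: run_simps)
          next
            case False
            then have "mark_step Act j u V = V"
              by (auto simp: mark_step_def u)
            moreover have "marked (set_var EQS n s3) V" for n
              using mk by (auto elim: marked_cong)
            ultimately show ?thesis
              using False 1 2 3 xs(2) Cons.prems(1) by (auto simp: run_simps)
          qed
        qed
      qed (use 1 st Cons.prems(6) in \<open>auto simp: marked_def\<close>)
    qed
    fix t1 and s1 :: hstate assume 1: "?R t1 s1" and "frame mark_eq s s1"
    then have fr: "ar s1 Eqs = ar s Eqs" "ar s1 Coef = ar s Coef" "vs s1 LEVEL = vs s LEVEL"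
      by (auto simp: frame_def mark_eq_def count_var_def mark_var_def)
    show "run (Loop EQS mark_eq) s1 (\<lambda>t2. ?Q (Suc (t1 + t2)))"
      by (rule run_mono[OF Cons.IH[where p = ?q and V = "mark_step Act j u V"]])
        (use 1 fr st Cons.prems in auto)
  qed
qed

lemma run_mark_levels:
  assumes "vs s LEVEL = int j" "vs s NEQS = int (length us)"
    "stored (ar s Eqs) 0 (concat (map (eq_code T) us))" "\<And>v. T v \<ge> 0" "marked s V"
    "\<forall>(xs, a)\<in>set us. distinct xs \<and> length xs \<le> c \<and>
      (ar s Coef (nat (mask T xs)) \<noteq> 0 \<longleftrightarrow> set xs \<in> Act)"
  shows "run (Loop LEVEL mark_level) s (\<lambda>t s'. t \<le> ((17 * c + 20) * length us + 5) * j + 1 \<and>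
    marked s' (mark_all Act j us V))"
  using assms
proof (induction j arbitrary: s V)
  case 0
  then show ?case
    by (subst run_Loop) simp
next
  case (Suc j)
  let ?V = "fold (mark_step Act (Suc j)) us V"
  show ?case (is "run _ _ ?Q")
  proof (rule run_LoopI)
    show "vs s LEVEL > 0"
      using Suc.prems by simp
    show "run mark_level s (\<lambda>t s1. t \<le> (17 * c + 20) * length us + 4 \<and> vs s1 LEVEL = int j \<and>
        marked s1 ?V)" (is "run _ _ ?R")
      unfolding mark_level_def
    proof (rule run_SeqI)
      show "run (move PTR (Imm 0) ;; move EQS (Reg NEQS)) s (\<lambda>t s1. t = 2 \<and> vs s1 PTR = int 0 \<and>
          vs s1 EQS = int (length us) \<and> vs s1 LEVEL = int (Suc j) \<and> ar s1 = ar s \<and>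
          vs s1 NVARS = vs s NVARS)" (is "run _ _ ?R1")
        using Suc.prems by (simp add: run_simps)
      fix t1 and s1 :: hstate assume 1: "?R1 t1 s1"
      show "run (Loop EQS mark_eq ;; decr LEVEL) s1 (\<lambda>t2. ?R (t1 + t2))"
      proof (rule run_SeqI[OF run_mark_eqs[where p = 0 and V = V and j = "Suc j" and us = us and T = T and c = c and Act = Act]])
        fix t2 and s2 :: hstate
        assume 2: "t2 \<le> (17 * c + 20) * length us + 1 \<and> marked s2 ?V"
          and "frame (Loop EQS mark_eq) s1 s2"
        then have "vs s2 LEVEL = vs s1 LEVEL"
          by (auto simp: frame_def mark_eq_def count_var_def mark_var_def)
        then show "run (decr LEVEL) s2 (\<lambda>t3. ?R (t1 + (t2 + t3)))"
          using 1 2 by (auto simp: run_simps elim: marked_cong)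
      qed (use 1 Suc.prems in \<open>auto elim: marked_cong\<close>)
    qed
    fix t1 and s1 :: hstate assume 1: "?R t1 s1" and "frame mark_level s s1"
    then have fr: "ar s1 Eqs = ar s Eqs" "ar s1 Coef = ar s Coef" "vs s1 NEQS = vs s NEQS"
      by (auto simp: frame_def mark_level_def mark_eq_def count_var_def mark_var_def)
    show "run (Loop LEVEL mark_level) s1 (\<lambda>t2. ?Q (Suc (t1 + t2)))"
      by (rule run_mono[OF Suc.IH[where V = ?V]]) (use 1 fr Suc.prems in auto)
  qed
qed

section \<open>Evaluating and enumerating assignments\<close>

text \<open>\<open>r\<close> counts the true variables met so far; leaving it arbitrary lets the
  parity pass through the induction.\<close>

lemma run_eval_vars:
  assumes "vs s LEFT = int (length ys)" "vs s PTR = int p" "stored (ar s Eqs) p (map int ys)"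
    "ar s Val = (\<lambda>v. of_bool (v \<in> X))" "vs s PARITY = of_bool (odd r)"
  shows "run (Loop LEFT eval_var) s (\<lambda>t s'. t \<le> 8 * length ys + 1 \<and>
    vs s' PTR = int (p + length ys) \<and>
    vs s' PARITY = of_bool (odd (r + length (filter (\<lambda>v. v \<in> X) ys))))"
  using assms
proof (induction ys arbitrary: s p r)
  case Nil
  then show ?case
    by (subst run_Loop) simp
next
  case (Cons y ys)
  show ?case (is "run _ _ ?Q")
  proof (rule run_LoopI)
    show "vs s LEFT > 0"
      using Cons.prems by simp
    show "run eval_var s (\<lambda>t s1. t \<le> 7 \<and> vs s1 LEFT = int (length ys) \<and> vs s1 PTR = int (Suc p) \<and>
        vs s1 PARITY = of_bool (odd (r + of_bool (y \<in> X))) \<and> ar s1 = ar s)" (is "run _ _ ?R")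
      using Cons.prems by (auto simp: eval_var_def run_simps)
    fix t1 and s1 :: hstate assume 1: "?R t1 s1"
    show "run (Loop LEFT eval_var) s1 (\<lambda>t2. ?Q (Suc (t1 + t2)))"
      by (rule run_mono[OF Cons.IH[where p = "Suc p" and r = "r + of_bool (y \<in> X)"]])
        (use 1 Cons.prems in auto)
  qed
qed

lemma chi_eq_parity:
  "distinct xs \<Longrightarrow> chi (set xs) X = (if odd (length (filter (\<lambda>v. v \<in> X) xs)) then -1 else 1)"
  by (simp add: chi_def distinct_length_filter Int_commute)

lemma run_eval_eqs:
  assumes "vs s EQS = int (length us)" "vs s PTR = int p"
    "stored (ar s Eqs) p (concat (map (eq_code T) us))" "ar s Val = (\<lambda>v. of_bool (v \<in> X))"
    "\<forall>(xs, a)\<in>set us. distinct xs \<and> length xs \<le> c"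
  shows "run (Loop EQS eval_eq) s (\<lambda>t s'. t \<le> (8 * c + 11) * length us + 1 \<and>
    vs s' TOTAL = vs s TOTAL + excess us X)"
  using assms
proof (induction us arbitrary: s p)
  case Nil
  then show ?case
    by (subst run_Loop) (simp add: excess_def)
next
  case (Cons u us)
  obtain xs a where u: "u = (xs, a)"
    by (cases u)
  let ?q = "p + length xs + 3"
  have xs: "distinct xs" "length xs \<le> c"
    using Cons.prems(5) u by auto
  have st: "ar s Eqs p = int (length xs)" "stored (ar s Eqs) (Suc p) (map int xs)"
      "ar s Eqs (Suc (Suc (p + length xs))) = a"
      "stored (ar s Eqs) ?q (concat (map (eq_code T) us))"
    using Cons.prems(3) by (simp_all add: u stored_append eval_nat_numeral)
  show ?case (is "run _ _ ?Q")
  proof (rule run_LoopI)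
    show "vs s EQS > 0"
      using Cons.prems by simp
    show "run eval_eq s (\<lambda>t s1. t \<le> 8 * c + 10 \<and> vs s1 EQS = int (length us) \<and> vs s1 PTR = int ?q \<and>
        vs s1 TOTAL = vs s TOTAL + a * chi (set xs) X)" (is "run _ _ ?R")
      unfolding eval_eq_def
    proof (rule run_SeqI)
      show "run (Get LEFT Eqs PTR ;; incr PTR ;; move PARITY (Imm 0)) s (\<lambda>t s1. t = 3 \<and>
          vs s1 LEFT = int (length xs) \<and> vs s1 PTR = int (Suc p) \<and> vs s1 PARITY = 0 \<and> ar s1 = ar s \<and>
          vs s1 EQS = vs s EQS \<and> vs s1 TOTAL = vs s TOTAL)" (is "run _ _ ?R1")
        using Cons.prems st by (simp add: run_simps)
      fix t1 and s1 :: hstate assume 1: "?R1 t1 s1"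
      show "run (Loop LEFT eval_var ;; incr PTR ;; Get WT Eqs PTR ;; incr PTR ;;
          Cond PARITY (Minus TOTAL (Reg TOTAL) (Reg WT)) (Plus TOTAL (Reg TOTAL) (Reg WT)) ;;
          decr EQS) s1 (\<lambda>t2. ?R (t1 + t2))"
      proof (rule run_SeqI[OF run_eval_vars[where p = "Suc p" and X = X and r = 0 and ys = xs]])
        fix t2 and s2 :: hstate
        assume 2: "t2 \<le> 8 * length xs + 1 \<and> vs s2 PTR = int (Suc p + length xs) \<and>
            vs s2 PARITY = of_bool (odd (0 + length (filter (\<lambda>v. v \<in> X) xs)))"
          and "frame (Loop LEFT eval_var) s1 s2"
        then have fr: "ar s2 = ar s" "vs s2 EQS = vs s EQS" "vs s2 TOTAL = vs s TOTAL"
          using 1 by (auto simp: frame_def eval_var_def fun_eq_iff)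
        show "run (incr PTR ;; Get WT Eqs PTR ;; incr PTR ;;
          Cond PARITY (Minus TOTAL (Reg TOTAL) (Reg WT)) (Plus TOTAL (Reg TOTAL) (Reg WT)) ;;
          decr EQS) s2 (\<lambda>t3. ?R (t1 + (t2 + t3)))"
          using 1 2 fr xs st(3) Cons.prems(1)
          by (simp add: run_simps chi_eq_parity nat_add_distrib)
      qed (use 1 st Cons.prems in auto)
    qed
    fix t1 and s1 :: hstate assume 1: "?R t1 s1" and "frame eval_eq s s1"
    then have fr: "ar s1 = ar s"
      by (auto simp: frame_def eval_eq_def eval_var_def fun_eq_iff)
    show "run (Loop EQS eval_eq) s1 (\<lambda>t2. ?Q (Suc (t1 + t2)))"
      by (rule run_mono[OF Cons.IH[where p = ?q]])
        (use 1 fr st Cons.prems in \<open>auto simp: excess_def u\<close>)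
  qed
qed

text \<open>Binary increment with the lowest digit at the head of the list, where membership in
  \<open>X\<close> is the digit 1.\<close>

fun carry :: "nat list \<Rightarrow> nat set \<Rightarrow> nat set" where
  "carry [] X = X"
| "carry (v # l) X = (if v \<in> X then carry l (X - {v}) else insert v X)"

fun bin_value :: "nat list \<Rightarrow> nat set \<Rightarrow> nat" where
  "bin_value [] X = 0"
| "bin_value (v # l) X = of_bool (v \<in> X) + 2 * bin_value l X"

lemma bin_value_cong: "(\<And>v. v \<in> set l \<Longrightarrow> v \<in> X \<longleftrightarrow> v \<in> Y) \<Longrightarrow> bin_value l X = bin_value l Y"
  by (induction l) auto

lemma bin_value_less: "bin_value l X < 2 ^ length l"
  by (induction l) auto

lemma bin_value_full: "set l \<subseteq> X \<Longrightarrow> Suc (bin_value l X) = 2 ^ length l"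
  by (induction l) auto

lemma bin_value_inj: "bin_value l X = bin_value l Y \<Longrightarrow> v \<in> set l \<Longrightarrow> v \<in> X \<longleftrightarrow> v \<in> Y"
proof (induction l)
  case (Cons w l)
  have "w \<in> X \<longleftrightarrow> w \<in> Y" "bin_value l X = bin_value l Y"
    using Cons.prems(1) by (auto simp: of_bool_def split: if_splits) presburger+
  then show ?case
    using Cons by auto
qed simp

lemma carry_subset: "carry l X \<subseteq> X \<union> set l"
  by (induction l arbitrary: X) (auto split: if_splits)

lemma carry_notin: "v \<notin> set l \<Longrightarrow> v \<in> carry l X \<longleftrightarrow> v \<in> X"
  by (induction l arbitrary: X) auto

lemma bin_value_carry:
  "distinct l \<Longrightarrow> \<not> set l \<subseteq> X \<Longrightarrow> bin_value l (carry l X) = Suc (bin_value l X)"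
proof (induction l arbitrary: X)
  case (Cons v l)
  show ?case
  proof (cases "v \<in> X")
    case True
    have "bin_value l (carry l (X - {v})) = Suc (bin_value l (X - {v}))"
      using Cons True by (intro Cons.IH) auto
    moreover have "bin_value l (X - {v}) = bin_value l X"
      using Cons.prems by (intro bin_value_cong) auto
    moreover have "v \<notin> carry l (X - {v})"
      using Cons.prems carry_notin[of v l "X - {v}"] by simp
    ultimately show ?thesis
      using True by simp
  next
    case False
    moreover have "bin_value l (insert v X) = bin_value l X"
      using Cons.prems by (intro bin_value_cong) auto
    ultimately show ?thesis
      by simp
  qed
qed simp

text \<open>A carry may run through the whole list. This is affordable: the list is no longer than
  linear in the number of equations, and evaluating the system takes linear time anyway.\<close>

lemma run_carry:
  assumes "vs s CARRY = 1" "vs s IDX = int i" "vs s NVARS = int (i + length l)"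
    "stored (ar s Order) i (map int l)" "ar s Val = (\<lambda>v. of_bool (v \<in> X))" "distinct l"
  shows "run (Loop CARRY carry_step) s (\<lambda>t s'. t \<le> 8 * length l + 9 \<and>
    ar s' Val = (\<lambda>v. of_bool (v \<in> carry l X)) \<and> vs s' GO = (if set l \<subseteq> X then 0 else vs s GO))"
  using assms
proof (induction l arbitrary: s i X)
  case Nil
  then show ?case
    by (subst run_Loop, simp add: carry_step_def run_simps, subst run_Loop) simp
next
  case (Cons v l)
  show ?case (is "run _ _ ?Q")
  proof (rule run_LoopI)
    show "vs s CARRY > 0"
      using Cons.prems by simp
    show "run carry_step s (\<lambda>t s1. t \<le> 7 \<and> vs s1 GO = vs s GO \<and> ar s1 Order = ar s Order \<and>
        vs s1 NVARS = vs s NVARS \<and>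
        (if v \<in> X then vs s1 CARRY = 1 \<and> vs s1 IDX = int (Suc i) \<and>
           ar s1 Val = (\<lambda>w. of_bool (w \<in> X - {v}))
         else vs s1 CARRY = 0 \<and> ar s1 Val = (\<lambda>w. of_bool (w \<in> insert v X))))" (is "run _ _ ?R")
      using Cons.prems by (auto simp: carry_step_def run_simps fun_eq_iff)
    fix t1 and s1 :: hstate assume 1: "?R t1 s1"
    show "run (Loop CARRY carry_step) s1 (\<lambda>t2. ?Q (Suc (t1 + t2)))"
    proof (cases "v \<in> X")
      case True
      show ?thesis
        by (rule run_mono[OF Cons.IH[where i = "Suc i" and X = "X - {v}"]])
          (use 1 True Cons.prems in auto)
    next
      case False
      then show ?thesis
        using 1 by (subst run_Loop) simp
    qed
  qed
qed

lemma run_search_step: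
  assumes "vs s NEQS = int (length us)" "vs s PARAM = int k"
    "stored (ar s Eqs) 0 (concat (map (eq_code T) us))" "ar s Val = (\<lambda>v. of_bool (v \<in> X))"
    "\<forall>(xs, a)\<in>set us. distinct xs \<and> length xs \<le> c"
    "vs s NVARS = int (length l)" "stored (ar s Order) 0 (map int l)" "distinct l" "vs s GO = 1"
  shows "run search_step s (\<lambda>t s'. t \<le> (8 * c + 11) * length us + 8 * length l + 18 \<and>
    (if excess us X \<ge> int k then vs s' RES = 1 \<and> vs s' GO = 0
     else vs s' RES = vs s RES \<and> ar s' Val = (\<lambda>v. of_bool (v \<in> carry l X)) \<and>
       vs s' GO = of_bool (\<not> set l \<subseteq> X)))" (is "run _ _ ?R")
  unfolding search_step_def
proof (rule run_SeqI)
  show "run (move TOTAL (Imm 0) ;; move PTR (Imm 0) ;; move EQS (Reg NEQS)) s (\<lambda>t s1. t = 3 \<and>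
      vs s1 TOTAL = 0 \<and> vs s1 PTR = int 0 \<and> vs s1 EQS = int (length us) \<and> ar s1 = ar s \<and>
      vs s1 PARAM = int k \<and> vs s1 NVARS = int (length l) \<and> vs s1 GO = 1 \<and> vs s1 RES = vs s RES)"
    (is "run _ _ ?R1")
    using assms by (simp add: run_simps)
  fix t1 and s1 :: hstate assume 1: "?R1 t1 s1"
  let ?c = "Cond TMP (move RES (Imm 1) ;; move GO (Imm 0))
    ((move IDX (Imm 0) ;; move CARRY (Imm 1)) ;; Loop CARRY carry_step)"
  show "run (Loop EQS eval_eq ;; (Minus TMP (Reg TOTAL) (Reg PARAM) ;; incr TMP) ;; ?c) s1
    (\<lambda>t2. ?R (t1 + t2))"
  proof (rule run_SeqI[OF run_eval_eqs[where p = 0 and X = X and us = us and T = T and c = c]])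
    fix t2 and s2 :: hstate
    assume 2: "t2 \<le> (8 * c + 11) * length us + 1 \<and> vs s2 TOTAL = vs s1 TOTAL + excess us X"
      and "frame (Loop EQS eval_eq) s1 s2"
    then have fr: "ar s2 = ar s" "vs s2 PARAM = int k" "vs s2 NVARS = int (length l)" "vs s2 GO = 1"
        "vs s2 RES = vs s RES"
      using 1 by (auto simp: frame_def eval_eq_def eval_var_def fun_eq_iff)
    show "run ((Minus TMP (Reg TOTAL) (Reg PARAM) ;; incr TMP) ;; ?c) s2 (\<lambda>t3. ?R (t1 + (t2 + t3)))"
    proof (rule run_SeqI)
      show "run (Minus TMP (Reg TOTAL) (Reg PARAM) ;; incr TMP) s2 (\<lambda>t s3. t = 2 \<and>
          (vs s3 TMP > 0 \<longleftrightarrow> excess us X \<ge> int k) \<and> ar s3 = ar s \<and> vs s3 NVARS = int (length l) \<and>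
          vs s3 GO = 1 \<and> vs s3 RES = vs s RES)" (is "run _ _ ?R3")
        using 1 2 fr by (auto simp: run_simps)
      fix t3 and s3 :: hstate assume 3: "?R3 t3 s3"
      show "run ?c s3 (\<lambda>t4. ?R (t1 + (t2 + (t3 + t4))))"
      proof (cases "excess us X \<ge> int k")
        case True
        then show ?thesis
          using 1 2 3 by (simp add: run_simps)
      next
        case False
        have "run ((move IDX (Imm 0) ;; move CARRY (Imm 1)) ;; Loop CARRY carry_step) s3
          (\<lambda>t4. ?R (t1 + (t2 + (t3 + Suc t4))))"
        proof (rule run_SeqI)
          show "run (move IDX (Imm 0) ;; move CARRY (Imm 1)) s3 (\<lambda>t s4. t = 2 \<and> vs s4 IDX = int 0 \<and>
              vs s4 CARRY = 1 \<and> ar s4 = ar s \<and> vs s4 NVARS = int (length l) \<and> vs s4 GO = 1 \<and>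
              vs s4 RES = vs s RES)" (is "run _ _ ?R4")
            using 3 by (simp add: run_simps)
          fix t4 and s4 :: hstate assume 4: "?R4 t4 s4"
          show "run (Loop CARRY carry_step) s4 (\<lambda>t5. ?R (t1 + (t2 + (t3 + Suc (t4 + t5)))))"
          proof (rule run_mono[OF run_carry[where i = 0 and l = l and X = X]])
            fix t5 and s5 :: hstate
            assume 5: "t5 \<le> 8 * length l + 9 \<and> ar s5 Val = (\<lambda>v. of_bool (v \<in> carry l X)) \<and>
                vs s5 GO = (if set l \<subseteq> X then 0 else vs s4 GO)"
              and "frame (Loop CARRY carry_step) s4 s5"
            then have "vs s5 RES = vs s4 RES"
              by (auto simp: frame_def carry_step_def)
            then show "?R (t1 + (t2 + (t3 + Suc (t4 + t5)))) s5"
              using 1 2 3 4 5 False by simp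
          qed (use 4 assms in auto)
        qed
        then show ?thesis
          using 3 False by (simp only: run_simps if_False)
      qed
    qed
  qed (use 1 assms in auto)
qed

text \<open>Induction on the number of counter values from the current one upwards; the last
  hypothesis says that all smaller values failed. The 20 per assignment exceeds the 18 of one step
  by the loop test and the test that ends the loop.\<close>

lemma run_search:
  assumes "vs s NEQS = int (length us)" "vs s PARAM = int k"
    "stored (ar s Eqs) 0 (concat (map (eq_code T) us))"
    "\<forall>(xs, a)\<in>set us. distinct xs \<and> length xs \<le> c"
    "vs s NVARS = int (length l)" "stored (ar s Order) 0 (map int l)" "distinct l"
    "ar s Val = (\<lambda>v. of_bool (v \<in> X))" "X \<subseteq> set l" "vs s GO = 1" "vs s RES = 0"
    "\<And>Y. Y \<subseteq> set l \<Longrightarrow> bin_value l Y < bin_value l X \<Longrightarrow> excess us Y < int k"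
  shows "run (Loop GO search_step) s (\<lambda>t s'.
    t \<le> (2 ^ length l - bin_value l X) * ((8 * c + 11) * length us + 8 * length l + 20) \<and>
    vs s' RES = of_bool (\<exists>Y\<subseteq>set l. excess us Y \<ge> int k))"
  using assms(1-3,5,6,8-12)
proof (induction "2 ^ length l - bin_value l X" arbitrary: s X rule: less_induct)
  case less
  let ?B = "(8 * c + 11) * length us + 8 * length l + 20"
  show ?case (is "run _ _ ?Q")
  proof (rule run_LoopI)
    show "vs s GO > 0"
      using less.prems by simp
    show "run search_step s (\<lambda>t s'. t \<le> (8 * c + 11) * length us + 8 * length l + 18 \<and>
      (if excess us X \<ge> int k then vs s' RES = 1 \<and> vs s' GO = 0
       else vs s' RES = vs s RES \<and> ar s' Val = (\<lambda>v. of_bool (v \<in> carry l X)) \<and>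
         vs s' GO = of_bool (\<not> set l \<subseteq> X)))" (is "run _ _ ?R")
      by (rule run_search_step) (use less.prems assms(4,7) in auto)
    fix t1 and s1 :: hstate assume 1: "?R t1 s1" and "frame search_step s s1"
    then have fr: "ar s1 Eqs = ar s Eqs" "ar s1 Order = ar s Order" "vs s1 NEQS = vs s NEQS"
        "vs s1 PARAM = vs s PARAM" "vs s1 NVARS = vs s NVARS"
      by (auto simp: frame_def search_step_def eval_eq_def eval_var_def carry_step_def)
    have pos: "2 ^ length l - bin_value l X \<ge> 1"
      using bin_value_less[of l X] by linarith
    then have B: "?B \<le> (2 ^ length l - bin_value l X) * ?B"
      by (metis mult_le_mono1 nat_mult_1)
    have T: "Suc (t1 + 1) \<le> (2 ^ length l - bin_value l X) * ?B"
      using 1 B by linarith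
    show "run (Loop GO search_step) s1 (\<lambda>t2. ?Q (Suc (t1 + t2)))"
    proof (cases "excess us X \<ge> int k")
      case True
      then have "\<exists>Y\<subseteq>set l. excess us Y \<ge> int k"
        using less.prems by blast
      then show ?thesis
        using 1 True T by (subst run_Loop) simp
    next
      case False
      show ?thesis
      proof (cases "set l \<subseteq> X")
        case full: True
        \<comment> \<open>The full set has the largest counter value, so every other subset was
          tried before.\<close>
        have "excess us Y < int k" if Y: "Y \<subseteq> set l" for Y
        proof (cases "bin_value l Y = bin_value l X")
          case True
          then have "X = Y"
            using bin_value_inj[OF True] Y less.prems(7) full by blast
          then show ?thesis
            using False by simp
        next
          case False
          then have "bin_value l Y < bin_value l X"
            using bin_value_full[OF full] bin_value_less[of l Y] by linarith
          then show ?thesis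
            using less.prems(10) Y by blast
        qed
        then have "\<not> (\<exists>Y\<subseteq>set l. excess us Y \<ge> int k)"
          by (meson not_le)
        then show ?thesis
          using 1 False full T less.prems(9) by (subst run_Loop) simp
      next
        case nfull: False
        have bv: "bin_value l (carry l X) = Suc (bin_value l X)"
          using nfull assms(7) by (rule bin_value_carry[rotated])
        show ?thesis
        proof (rule run_mono[OF less.hyps[of "carry l X"]])
          show "2 ^ length l - bin_value l (carry l X) < 2 ^ length l - bin_value l X"
            using pos bv by linarith
          show "carry l X \<subseteq> set l"
            using carry_subset[of l X] less.prems(7) by blast
          \<comment> \<open>Below the successor there are only the current assignment, which just
            failed, and earlier ones.\<close>
          show "excess us Y < int k" if "Y \<subseteq> set l" "bin_value l Y < bin_value l (carry l X)" for Y
          proof (cases "bin_value l Y = bin_value l X")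
            case True
            then have "X = Y"
              using bin_value_inj[OF True] that(1) less.prems(7) by blast
            then show ?thesis
              using False by simp
          next
            case False
            then show ?thesis
              using that bv less.prems(10) by simp
          qed
          fix t2 and s2 :: hstate
          assume 2: "t2 \<le> (2 ^ length l - bin_value l (carry l X)) * ?B \<and>
            vs s2 RES = of_bool (\<exists>Y\<subseteq>set l. excess us Y \<ge> int k)"
          have "2 ^ length l - bin_value l X = Suc (2 ^ length l - bin_value l (carry l X))"
            using pos bv by linarith
          then have "(2 ^ length l - bin_value l X) * ?B = ?B + (2 ^ length l - bin_value l (carry l X)) * ?B"
            by (simp only: mult_Suc)
          moreover have "Suc t1 \<le> ?B"
            using 1 by simp
          ultimately have "Suc (t1 + t2) \<le> (2 ^ length l - bin_value l X) * ?B"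
            using 2 by linarith
          then show "?Q (Suc (t1 + t2)) s2"
            using 2 by blast
        qed (use 1 fr False nfull less.prems in auto)
      qed
    qed
  qed
qed

section \<open>Correctness and running time of the whole program\<close>

lemma run_bound:
  assumes "vs s TMP = int d"
  shows "run (Loop TMP bound_step) s (\<lambda>t s'. t \<le> 4 * d + 1 \<and>
    vs s' BOUND = vs s BOUND + int d * (vs s PARAM - 1))"
  using assms
proof (induction d arbitrary: s)
  case 0
  then show ?case
    by (subst run_Loop) simp
next
  case (Suc d)
  show ?case (is "run _ _ ?Q")
  proof (rule run_LoopI)
    show "vs s TMP > 0"
      using Suc.prems by simp
    show "run bound_step s (\<lambda>t s1. t = 3 \<and> vs s1 TMP = int d \<and> vs s1 PARAM = vs s PARAM \<and>
        vs s1 BOUND = vs s BOUND + (vs s PARAM - 1))" (is "run _ _ ?R")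
      using Suc.prems by (simp add: bound_step_def run_simps)
    fix t1 and s1 :: hstate assume 1: "?R t1 s1"
    show "run (Loop TMP bound_step) s1 (\<lambda>t2. ?Q (Suc (t1 + t2)))"
      by (rule run_mono[OF Suc.IH]) (use 1 in \<open>auto simp: algebra_simps\<close>)
  qed
qed

definition instance_terms :: "nat \<Rightarrow> term_list \<Rightarrow> bool" where
  "instance_terms c us \<longleftrightarrow> (\<forall>(xs, a)\<in>set us. distinct xs \<and> xs \<noteq> [] \<and> length xs \<le> c)"

definition marked_vars :: "nat \<Rightarrow> term_list \<Rightarrow> nat set" where
  "marked_vars c us = mark_all (active us) c us {}"

lemma active_terms:
  assumes "instance_terms c us" "S \<in> active us"
  shows "finite S" "S \<noteq> {}" "card S \<le> c" "coef us S \<noteq> 0" "S \<in> set ` fst ` set us"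
proof -
  obtain xs a where xs: "(xs, a) \<in> set us" "S = set xs" "coef us S \<noteq> 0"
    using assms(2) by (auto simp: active_def)
  have "distinct xs" "xs \<noteq> []" "length xs \<le> c"
    using assms(1) xs(1) by (auto simp: instance_terms_def)
  then show "finite S" "S \<noteq> {}" "card S \<le> c" "coef us S \<noteq> 0"
    using xs by (simp_all add: distinct_card)
  show "S \<in> set ` fst ` set us"
    unfolding xs(2) using xs(1) by (metis fst_conv imageI)
qed

lemma active_subset_marked_vars:
  "instance_terms c us \<Longrightarrow> S \<in> active us \<Longrightarrow> S \<subseteq> marked_vars c us"
  unfolding marked_vars_def by (intro mark_all_covers) (simp_all add: active_terms)

text \<open>Keeps the cost of a counter increment linear in the number of equations.\<close>

lemma card_marked_vars_le:
  assumes "instance_terms c us"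
  shows "card (marked_vars c us) \<le> c * length us"
proof -
  have "marked_vars c us \<subseteq> (\<Union>u\<in>set us. set (fst u))"
    using mark_all_subset[of "{}"] by (simp add: marked_vars_def)
  then have "card (marked_vars c us) \<le> card (\<Union>u\<in>set us. set (fst u))"
    by (intro card_mono) auto
  also have "\<dots> \<le> (\<Sum>u\<in>set us. card (set (fst u)))"
    by (rule card_UN_le) simp
  also have "\<dots> \<le> (\<Sum>u\<in>set us. c)"
    using assms by (intro sum_mono) (auto simp: instance_terms_def distinct_card)
  also have "\<dots> \<le> c * length us"
    using card_length[of us] by (simp add: mult.commute)
  finally show ?thesis .
qed

text \<open>The comparison is in integers, as the program makes it; for \<open>k = 0\<close>
  truncated subtraction would give a different bound, hence the case split.\<close>

lemma excess_ge_if_many_marked: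
  assumes us: "instance_terms c us" and "c > 0"
    and many: "int (card (marked_vars c us)) > int (c * (c + 1) div 2) * (int k - 1)"
  shows "\<exists>X. excess us X \<ge> int k"
proof (cases "k = 0")
  case True
  \<comment> \<open>With no picked sets the lower bound says that the average excess 0 is attained
    or exceeded.\<close>
  have "\<exists>X. (\<Sum>S\<in>active us. coef us S * chi S X) \<ge> int (card ({} :: nat set set))"
    using active_terms[OF us] finite_active \<open>c > 0\<close>
    by (intro exists_ge_card_disjoint[of "{}" _ _ c]) auto
  then show ?thesis
    using True by (simp add: excess_eq_sum_active)
next
  case False
  show ?thesis
  proof (rule ccontr)
    assume "\<not> ?thesis"
    then have "card (marked_vars c us) \<le> card ({} :: nat set) + (c * (c + 1) div 2) * (k - 1)"
      unfolding marked_vars_def using us active_terms[OF us]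
      by (intro card_mark_all) (auto simp: instance_terms_def not_le)
    then have "int (card (marked_vars c us)) \<le> int ((c * (c + 1) div 2) * (k - 1))"
      by (simp only: of_nat_le_iff card.empty add_0)
    also have "\<dots> = int (c * (c + 1) div 2) * (int k - 1)"
      using False by (simp only: of_nat_mult) (simp add: of_nat_diff)
    finally show False
      using many by simp
  qed
qed

lemma exists_excess_marked:
  assumes "instance_terms c us"
  shows "(\<exists>Y\<subseteq>marked_vars c us. excess us Y \<ge> k) \<longleftrightarrow> (\<exists>X. excess us X \<ge> k)"
proof
  assume "\<exists>X. excess us X \<ge> k"
  then obtain X where "excess us X \<ge> k" ..
  then have "excess us (X \<inter> marked_vars c us) \<ge> k"
    using excess_restrict[OF active_subset_marked_vars[OF assms]] by simp
  then show "\<exists>Y\<subseteq>marked_vars c us. excess us Y \<ge> k"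
    by blast
qed auto

text \<open>Injectivity of code sums: entries share a cell of the array exactly if they have the
  same variables.\<close>

lemma coef_mask:
  assumes "table T b" "instance_terms c us" "\<forall>(xs, a)\<in>set us. \<forall>v\<in>set xs. T v > 0" "(xs, a) \<in> set us"
  shows "(\<Sum>(ys, b)\<leftarrow>us. if nat (mask T ys) = nat (mask T xs) then b else 0) = coef us (set xs)"
proof -
  have "nat (mask T ys) = nat (mask T xs) \<longleftrightarrow> set ys = set xs" if "(ys, b) \<in> set us" for ys b
    using assms that by (intro mask_eq_iff) (auto simp: instance_terms_def)
  then show ?thesis
    unfolding coef_def by (intro arg_cong[of _ _ sum_list] map_cong) auto
qed

text \<open>The summands pay for reading, for c marking passes, for computing the bound, for fixed
  overhead, and for trying one assignment.\<close>

definition time_const :: "nat \<Rightarrow> nat" where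
  "time_const c = (12 * c + 25) + (17 * c + 25) * c + 4 * (c * (c + 1) div 2) + 20 + (16 * c + 31)"

lemma run_solver:
  assumes us: "instance_terms c us" and "c > 0"
  shows "run (solver c) (initial_hstate (int k # int (length us) # concat (map input_code us)))
    (\<lambda>t s'. vs s' RES = of_bool (\<exists>X. excess us X \<ge> int k) \<and>
      (us \<noteq> [] \<longrightarrow> t \<le> time_const c * (2 ^ ((c * (c + 1) div 2) * k) * length us)))" (is "run _ ?s0 ?Q")
  unfolding solver_def
proof (rule run_SeqI)
  let ?D = "c * (c + 1) div 2" and ?m = "length us" and ?V = "marked_vars c us"
  show "run (Input PARAM ;; Input NEQS ;; move POW (Imm 1) ;; move EQS (Reg NEQS)) ?s0
    (\<lambda>t s1. t = 4 \<and> vs s1 PARAM = int k \<and> vs s1 NEQS = int ?m \<and> vs s1 EQS = int ?m \<and> vs s1 POW = 1 \<and>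
      vs s1 PTR = int 0 \<and> vs s1 NVARS = 0 \<and> vs s1 BOUND = 0 \<and> vs s1 RES = 0 \<and> ar s1 = (\<lambda>_ _. 0) \<and>
      ip s1 = concat (map input_code us))" (is "run _ _ ?R1")
    by (simp add: run_simps initial_hstate_def)
  fix t1 and s1 :: hstate assume 1: "?R1 t1 s1"
  let ?c5 = "Minus TMP (Reg NVARS) (Reg BOUND) ;;
     Cond TMP (move RES (Imm 1)) (move GO (Imm 1) ;; Loop GO search_step)"
  let ?c4 = "move TMP (Imm (int ?D)) ;; Loop TMP bound_step ;; ?c5"
  let ?c3 = "move LEVEL (Imm (int c)) ;; Loop LEVEL mark_level ;; ?c4"
  have len: "\<forall>(xs, a)\<in>set us. length xs \<le> c" "\<forall>(xs, a)\<in>set us. distinct xs \<and> length xs \<le> c"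
    using us by (auto simp: instance_terms_def)
  show "run (Loop EQS read_eq ;; ?c3) s1 (\<lambda>t2. ?Q (t1 + t2))"
  proof (rule run_SeqI[OF run_read_eqs[where p = 0 and us = us and c = c]])
    fix t2 and s2 :: hstate
    let ?T = "ar s2 Code"
    assume 2: "t2 \<le> (12 * c + 25) * ?m + 1 \<and> stored (ar s2 Eqs) 0 (concat (map (eq_code ?T) us)) \<and>
        (\<forall>i<0. ar s2 Eqs i = ar s1 Eqs i) \<and> table ?T (vs s2 POW) \<and> extends ?T (ar s1 Code) \<and>
        (\<forall>(xs, a)\<in>set us. \<forall>v\<in>set xs. ?T v > 0) \<and>
        (\<forall>i. ar s2 Coef i = ar s1 Coef i + (\<Sum>(xs, a)\<leftarrow>us. if nat (mask ?T xs) = i then a else 0))"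
      and "frame (Loop EQS read_eq) s1 s2"
    then have fr2: "vs s2 PARAM = int k" "vs s2 NEQS = int ?m" "vs s2 NVARS = 0" "vs s2 BOUND = 0"
        "vs s2 RES = 0" "ar s2 Mark = (\<lambda>_. 0)" "ar s2 Order = (\<lambda>_. 0)" "ar s2 Val = (\<lambda>_. 0)"
      using 1 by (auto simp: frame_def read_eq_def read_var_def)
    have act: "ar s2 Coef (nat (mask ?T xs)) \<noteq> 0 \<longleftrightarrow> set xs \<in> active us" if "(xs, a) \<in> set us" for xs a
    proof -
      have "ar s2 Coef (nat (mask ?T xs)) = coef us (set xs)"
        using 1 2 coef_mask[OF _ us _ that] by auto
      then show ?thesis
        using that by (force simp: active_def)
    qed
    have Tn: "?T v \<ge> 0" for v
      using 2 by (auto simp: table_def)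
    show "run ?c3 s2 (\<lambda>t3. ?Q (t1 + (t2 + t3)))"
    proof (rule run_SeqI)
      show "run (move LEVEL (Imm (int c))) s2 (\<lambda>t s3. t = 1 \<and> s3 = set_var LEVEL (int c) s2)" (is "run _ _ ?R3")
        by (simp add: run_simps)
      fix t3 and s3 :: hstate assume 3: "?R3 t3 s3"
      show "run (Loop LEVEL mark_level ;; ?c4) s3 (\<lambda>t4. ?Q (t1 + (t2 + (t3 + t4))))"
      proof (rule run_SeqI[OF run_mark_levels[where j = c and us = us and T = ?T and V = "{}" and c = c
              and Act = "active us"]])
        fix t4 and s4 :: hstate
        assume "t4 \<le> ((17 * c + 20) * ?m + 5) * c + 1 \<and> marked s4 (mark_all (active us) c us {})"
          and "frame (Loop LEVEL mark_level) s3 s4"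
        then have t4: "t4 \<le> ((17 * c + 20) * ?m + 5) * c + 1" and mk: "marked s4 ?V"
          and fr4: "vs s4 PARAM = int k" "vs s4 NEQS = int ?m" "vs s4 BOUND = 0"
            "vs s4 RES = 0" "ar s4 Val = (\<lambda>_. 0)" "ar s4 Eqs = ar s2 Eqs"
          using 3 fr2
          by (auto simp: frame_def mark_level_def mark_eq_def count_var_def mark_var_def marked_vars_def)
        obtain l where l: "distinct l" "set l = ?V" "vs s4 NVARS = int (length l)"
            "stored (ar s4 Order) 0 (map int l)"
          using mk by (auto simp: marked_def)
        have lV: "length l = card ?V"
          using l distinct_card by fastforce
        show "run ?c4 s4 (\<lambda>t5. ?Q (t1 + (t2 + (t3 + (t4 + t5)))))"
        proof (rule run_SeqI)
          show "run (move TMP (Imm (int ?D))) s4 (\<lambda>t s5. t = 1 \<and> s5 = set_var TMP (int ?D) s4)" (is "run _ _ ?R5")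
            by (simp add: run_simps)
          fix t5 and s5 :: hstate assume 5: "?R5 t5 s5"
          show "run (Loop TMP bound_step ;; ?c5) s5 (\<lambda>t6. ?Q (t1 + (t2 + (t3 + (t4 + (t5 + t6))))))"
          proof (rule run_SeqI[OF run_bound[where d = ?D]])
            fix t6 and s6 :: hstate
            assume 6: "t6 \<le> 4 * ?D + 1 \<and> vs s6 BOUND = vs s5 BOUND + int ?D * (vs s5 PARAM - 1)"
              and "frame (Loop TMP bound_step) s5 s6"
            then have fr6: "vs s6 PARAM = int k" "vs s6 NEQS = int ?m" "vs s6 RES = 0"
                "ar s6 = ar s4" "vs s6 NVARS = int (length l)"
              using 5 fr4 l by (auto simp: frame_def bound_step_def fun_eq_iff)
            have bd: "vs s6 BOUND = int ?D * (int k - 1)"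
              using 5 6 fr4 by simp
            let ?E = "2 ^ (?D * k) :: nat"
            define t where "t = t1 + (t2 + (t3 + (t4 + (t5 + t6))))"
            have tm: "t \<le> (12 * c + 25) * ?m + ((17 * c + 20) * ?m + 5) * c + 4 * ?D + 9"
              using 1 2 3 t4 5 6 by (simp add: t_def)
            \<comment> \<open>Terms without the factor \<open>?E * ?m\<close> are absorbed because
              it is at least 1. The 20 in \<open>time_const\<close> is the 9 of \<open>tm\<close>
              plus the 11 allowed for \<open>d\<close>.\<close>
            have time: "t + d \<le> time_const c * (?E * ?m)"
              if us0: "us \<noteq> []" and d: "d \<le> ?E * ((16 * c + 31) * ?m) + 11" for d
            proof -
              have m: "?m \<ge> 1" and E: "?E \<ge> 1"
                using us0 by (cases us) auto
              have "((17 * c + 20) * ?m + 5) * c \<le> ((17 * c + 20) * ?m + 5 * ?m) * c"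
                using m by (intro mult_le_mono1 add_mono mult_le_mono2) auto
              also have "\<dots> = (17 * c + 25) * c * ?m"
                by (simp add: algebra_simps)
              finally have f: "((17 * c + 20) * ?m + 5) * c \<le> (17 * c + 25) * c * ?m" .
              have "t + d \<le> ((12 * c + 25) + (17 * c + 25) * c) * ?m + 4 * ?D + 20 + ?E * ((16 * c + 31) * ?m)"
                using f tm d unfolding add_mult_distrib[of "12 * c + 25"] by linarith
              also have "\<dots> \<le> ((12 * c + 25) + (17 * c + 25) * c) * (?E * ?m) + 4 * ?D * (?E * ?m) +
                  20 * (?E * ?m) + (16 * c + 31) * (?E * ?m)"
              proof (intro add_mono)
                have Em: "?E * ?m \<ge> 1" "?m \<le> ?E * ?m"
                  using m E by auto
                show "((12 * c + 25) + (17 * c + 25) * c) * ?m \<le> ((12 * c + 25) + (17 * c + 25) * c) * (?E * ?m)"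
                  using Em(2) by (rule mult_le_mono2)
                show "4 * ?D \<le> 4 * ?D * (?E * ?m)" "20 \<le> 20 * (?E * ?m)"
                  using mult_le_mono2[OF Em(1), of "4 * ?D"] mult_le_mono2[OF Em(1), of 20] by simp_all
              qed (simp add: ac_simps)
              also have "\<dots> = time_const c * (?E * ?m)"
                by (simp only: time_const_def add_mult_distrib)
              finally show ?thesis .
            qed
            have "run ?c5 s6 (\<lambda>t7. ?Q (t + t7))"
            proof (rule run_SeqI)
              show "run (Minus TMP (Reg NVARS) (Reg BOUND)) s6 (\<lambda>t s7. t = 1 \<and>
                  s7 = set_var TMP (int (length l) - int ?D * (int k - 1)) s6)" (is "run _ _ ?R7")
                using fr6 bd by (simp add: run_simps)
              fix t7 and s7 :: hstate assume 7: "?R7 t7 s7"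
              show "run (Cond TMP (move RES (Imm 1)) (move GO (Imm 1) ;; Loop GO search_step)) s7
                (\<lambda>t8. ?Q (t + (t7 + t8)))"
              proof (cases "int (length l) > int ?D * (int k - 1)")
                case True
                then have "\<exists>X. excess us X \<ge> int k"
                  using excess_ge_if_many_marked[OF us \<open>c > 0\<close>] lV by simp
                moreover have "us \<noteq> [] \<longrightarrow> t + (1 + Suc 1) \<le> time_const c * (?E * ?m)"
                  using time[of "1 + Suc 1"] by simp
                ultimately show ?thesis
                  using 7 True by (simp add: run_simps)
              next
                case False
                \<comment> \<open>The tested bound has k - 1 in place of k; the weaker form suffices
                  for the exponent.\<close>
                then have "int (length l) \<le> int (?D * k)"
                  by (simp add: algebra_simps)
                then have "length l \<le> ?D * k"
                  by (simp only: of_nat_le_iff)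
                then have lE: "2 ^ length l \<le> ?E"
                  by (intro power_increasing) auto
                have "run (move GO (Imm 1) ;; Loop GO search_step) s7 (\<lambda>t8. ?Q (t + (t7 + Suc t8)))"
                proof (rule run_SeqI)
                  show "run (move GO (Imm 1)) s7 (\<lambda>t s8. t = 1 \<and> s8 = set_var GO 1 s7)" (is "run _ _ ?R8")
                    by (simp add: run_simps)
                  fix t8 and s8 :: hstate assume 8: "?R8 t8 s8"
                  show "run (Loop GO search_step) s8 (\<lambda>t9. ?Q (t + (t7 + Suc (t8 + t9))))"
                  proof (rule run_mono[OF run_search[where us = us and T = ?T and c = c and l = l and X = "{}" and k = k]])
                    fix t9 and s9 :: hstate
                    assume 9: "t9 \<le> (2 ^ length l - bin_value l {}) * ((8 * c + 11) * ?m + 8 * length l + 20) \<and>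
                      vs s9 RES = of_bool (\<exists>Y\<subseteq>set l. excess us Y \<ge> int k)"
                    have "us \<noteq> [] \<longrightarrow> t + (t7 + Suc (t8 + t9)) \<le> time_const c * (?E * ?m)"
                    proof
                      assume us0: "us \<noteq> []"
                      \<comment> \<open>Counter and overhead become multiples of the number of
                        equations; (8c + 11) + 8c + 20 gives 16c + 31.\<close>
                      have "8 * length l \<le> 8 * c * ?m" "20 \<le> 20 * ?m"
                        using card_marked_vars_le[OF us] lV us0 by (auto simp: Suc_le_eq)
                      then have "(8 * c + 11) * ?m + 8 * length l + 20 \<le> (16 * c + 31) * ?m"
                        by (simp add: add_mult_distrib)
                      then have "(2 ^ length l - bin_value l {}) * ((8 * c + 11) * ?m + 8 * length l + 20)
                          \<le> ?E * ((16 * c + 31) * ?m)"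
                        by (rule mult_le_mono[OF order_trans[OF diff_le_self lE]])
                      then have "t7 + Suc (t8 + t9) \<le> ?E * ((16 * c + 31) * ?m) + 11"
                        using 7 8 9 by linarith
                      then show "t + (t7 + Suc (t8 + t9)) \<le> time_const c * (?E * ?m)"
                        using time us0 by blast
                    qed
                    then show "?Q (t + (t7 + Suc (t8 + t9))) s9"
                      using 9 l(2) exists_excess_marked[OF us] by simp
                  next
                    fix Y assume "bin_value l Y < bin_value l {}"
                    moreover have "bin_value l {} = 0"
                      by (induction l) auto
                    ultimately show "excess us Y < int k"
                      by simp
                  next
                    show "stored (ar s8 Eqs) 0 (concat (map (eq_code ?T) us))"
                      using 2 7 8 fr4(6) fr6(4) by simp
                  qed (simp_all add: 7 8 fr4 fr6 l len)
                qed
                then show ?thesis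
                  using 7 False by (simp only: run_simps) simp
              qed
            qed
            then show "run ?c5 s6 (\<lambda>t7. ?Q (t1 + (t2 + (t3 + (t4 + (t5 + (t6 + t7)))))))"
              by (simp only: t_def add.assoc)
          qed (use 5 in simp)
        qed
      next
        show "stored (ar s3 Eqs) 0 (concat (map (eq_code ?T) us))"
          using 2 3 by simp
        show "marked s3 {}"
          using 3 fr2 by (simp add: marked_def)
        show "\<forall>(xs, a)\<in>set us. distinct xs \<and> length xs \<le> c \<and>
            (ar s3 Coef (nat (mask ?T xs)) \<noteq> 0 \<longleftrightarrow> set xs \<in> active us)"
          using 3 act len(2) by auto
      qed (use Tn in \<open>simp_all add: 3 fr2\<close>)
    qed
  qed (simp_all add: 1 len table_def)
qed

section \<open>From equations to signed terms\<close>

text \<open>A relation, as the encoding may list the variables in any order. The sign is chosen such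
  that a satisfied equation contributes its weight positively.\<close>

fun term_of :: "lin_eq \<Rightarrow> nat list \<times> int \<Rightarrow> bool" where
  "term_of e (xs, a) \<longleftrightarrow> distinct xs \<and> set xs = eq_vars e \<and>
     a = (if eq_rhs e = 1 then - int (eq_weight e) else int (eq_weight e))"

lemma encodes_eq_input_code:
  assumes "encodes_eq e zs" "eq_weight e > 0"
  shows "\<exists>u. term_of e u \<and> zs = input_code u"
proof -
  obtain xs where xs: "distinct xs" "set xs = eq_vars e"
      "zs = [int (length xs)] @ map int xs @ [of_bool (eq_rhs e = 1), int (eq_weight e)]"
    using assms(1) by (auto simp: encodes_eq_def)
  let ?a = "if eq_rhs e = 1 then - int (eq_weight e) else int (eq_weight e)"
  show ?thesis
    using xs assms(2) by (intro exI[of _ "(xs, ?a)"]) auto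
qed

lemma encodes_input_codes:
  assumes "list_all2 encodes_eq F zss" "\<forall>e\<in>set F. eq_weight e > 0"
  shows "\<exists>us. list_all2 term_of F us \<and> zss = map input_code us"
  using assms
proof (induction rule: list_all2_induct)
  case Nil
  then show ?case
    by simp
next
  case (Cons e F zs zss)
  then obtain u us where "term_of e u" "zs = input_code u" "list_all2 term_of F us" "zss = map input_code us"
    using encodes_eq_input_code by fastforce
  then show ?case
    by (intro exI[of _ "u # us"]) simp
qed

text \<open>An assignment is identified with the set of its true variables; each of them in
  \<open>S\<close> changes both the bit sum and the sign.\<close>

lemma chi_eq_bit_sum:
  fixes x :: "nat \<Rightarrow> bit"
  assumes "finite S"
  shows "chi S {i. x i = 1} = (if (\<Sum>i\<in>S. x i) = 1 then -1 else 1)"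
  using assms
proof induction
  case (insert v S)
  have "chi (insert v S) {i. x i = 1} = chi {v} {i. x i = 1} * chi S {i. x i = 1}"
    using insert chi_Un[of "{v}" S] by simp
  moreover have "chi {v} {i. x i = 1} = (if x v = 1 then -1 else 1)"
    by (simp add: chi_def)
  moreover have "x v + y = 1 \<longleftrightarrow> (x v = 1) \<noteq> (y = 1)" for y
    by (cases "x v"; cases y) auto
  ultimately show ?case
    using insert by simp
qed simp

text \<open>Satisfied minus falsified weight, with the falsified weight written as total minus
  satisfied.\<close>

lemma excess_eq_weights:
  assumes "list_all2 term_of F us" "\<forall>e\<in>set F. finite (eq_vars e)"
  shows "excess us {i. x i = 1} = 2 * int (assignment_weight F x) - int (total_weight F)"
  using assms
proof (induction rule: list_all2_induct)
  case Nil
  then show ?case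
    by (simp add: excess_def assignment_weight_def total_weight_def)
next
  case (Cons e F u us)
  obtain xs a where u: "u = (xs, a)"
    by (cases u)
  have *: "y = b \<longleftrightarrow> (y = 1 \<longleftrightarrow> b = 1)" for y b :: bit
    by (cases y; cases b) auto
  have "a * chi (set xs) {i. x i = 1} =
      (if satisfies x e then int (eq_weight e) else - int (eq_weight e))"
    using Cons u chi_eq_bit_sum[of "eq_vars e" x]
    by (auto simp: satisfies_def *[of "sum x (eq_vars e)" "eq_rhs e"])
  then show ?case
    using Cons by (auto simp: u excess_def assignment_weight_def total_weight_def)
qed

lemma above_average_iff_excess:
  assumes "list_all2 term_of F us" "\<forall>e\<in>set F. finite (eq_vars e)"
  shows "above_average k F \<longleftrightarrow> (\<exists>X. excess us X \<ge> int k)"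
proof -
  have *: "real (assignment_weight F x) \<ge> real (total_weight F) / 2 + real k / 2 \<longleftrightarrow>
      excess us {i. x i = 1} \<ge> int k" for x
    unfolding excess_eq_weights[OF assms] by linarith
  \<comment> \<open>Every set is the set of true variables of some assignment, so the two
    existential statements range over the same objects.\<close>
  have "{i. (of_bool (i \<in> X) :: bit) = 1} = X" for X :: "nat set"
    by auto
  then show ?thesis
    unfolding above_average_def * by metis
qed

theorem theorem2:
  fixes c :: nat
  assumes "c \<ge> 2"
  shows "\<exists>P :: instr list. \<exists>C :: real. \<forall>(k :: nat) (F :: lin_eq list) (zs :: int list).
           c_lin_system c F \<longrightarrow> encodes_instance k F zs \<longrightarrow>
           (\<exists>t. outputs_within P zs t (of_bool (above_average k F)) \<and>
                (F \<noteq> [] \<longrightarrow>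
                   real t \<le> C * (2 ^ ((c * (c + 1) div 2) * k) * real (length F))))"
proof (rule exI[of _ "compile 0 (solver c)"], rule exI[of _ "real (9 * time_const c)"], intro allI impI)
  fix k F zs
  assume F: "c_lin_system c F" and "encodes_instance k F zs"
  then obtain zss where zss: "list_all2 encodes_eq F zss" "zs = [int k, int (length F)] @ concat zss"
    by (auto simp: encodes_instance_def)
  obtain us where us: "list_all2 term_of F us" "zss = map input_code us"
    using encodes_input_codes[OF zss(1)] F by (auto simp: c_lin_system_def)
  have len: "length us = length F"
    using us(1) by (simp add: list_all2_lengthD)
  have "instance_terms c us"
    unfolding instance_terms_def
  proof clarify
    fix xs a assume "(xs, a) \<in> set us"
    then obtain e where "e \<in> set F" "term_of e (xs, a)"
      using us(1) by (metis in_set_conv_nth list_all2_conv_all_nth)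
    then show "distinct xs \<and> xs \<noteq> [] \<and> length xs \<le> c"
      using F by (auto simp: c_lin_system_def distinct_card[symmetric])
  qed
  then obtain t s' where t: "exec (solver c) (initial_hstate zs) t s'"
      "vs s' RES = of_bool (\<exists>X. excess us X \<ge> int k)"
      "us \<noteq> [] \<Longrightarrow> t \<le> time_const c * (2 ^ ((c * (c + 1) div 2) * k) * length us)"
    using run_solver[of c us k] assms zss(2) us(2) len by (auto simp: run_def)
  have "vs s' RES = of_bool (above_average k F)"
    using t(2) above_average_iff_excess[OF us(1)] F by (simp add: c_lin_system_def)
  then have "outputs_within (compile 0 (solver c)) zs (9 * t) (of_bool (above_average k F))"
    using outputs_within_compile[OF t(1)] by simp
  \<comment> \<open>The factor 9 is the overhead of compilation. For an empty system the right-hand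
    side would be 0, which no nonempty program run can meet.\<close>
  moreover have "real (9 * t) \<le>
      real (9 * time_const c) * (2 ^ ((c * (c + 1) div 2) * k) * real (length F))" if "F \<noteq> []"
  proof -
    have "us \<noteq> []"
      using that len by auto
    then have "9 * t \<le> 9 * time_const c * (2 ^ ((c * (c + 1) div 2) * k) * length us)"
      using t(3) by simp
    from of_nat_mono[OF this, where 'a = real] show ?thesis
      by (simp add: len)
  qed
  ultimately show "\<exists>t. outputs_within (compile 0 (solver c)) zs t (of_bool (above_average k F)) \<and>
      (F \<noteq> [] \<longrightarrow> real t \<le>
        real (9 * time_const c) * (2 ^ ((c * (c + 1) div 2) * k) * real (length F)))"
    by blast
qed

end
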